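(* Let $C\in\mathcal{C}_d$ be a closed convex cone. Then $$\operatorname{Var}[V_C]\le 2\,\big(\delta(C)\wedge\delta(C^\circ)\big),$$ where $\wedge$ denotes the minimum of two numbers.
   Context: $\mathbb{R}^d$ carries the standard inner product $\langle\cdot,\cdot\rangle$ and Euclidean norm $\|\cdot\|$. Cones. A convex cone $C\subset\mathbb{R}^d$ is a nonempty set with $\tau(x+y)\in C$ for all $\tau>0$, $x,y\in C$; $\mathcal{C}_d$ is the set of closed convex cones in $\mathbb{R}^d$. The polar cone is $C^\circ=\{u\in\mathbb{R}^d:\langle u,x\rangle\le 0 \text{ for all } x\in C\}\in\mathcal{C}_d$. The metric projector onto $C$ is $\Pi_C(x)=\arg\min\{\|x-y\|^2:y\in C\}$. A cone is polyhedral if it is a finite intersection of halfspaces $\{x:\langle u_i,x\rangle\ge0\}$. A face of a polyhedral cone $C$ is a set of the form $\{x\in C:\langle u,x\rangle=\sup_{y\in C}\langle u,y\rangle\}$ with $u\in C^\circ$; its dimension is the dimension of its linear hull, and its relative interior is its interior relative to its linear hull. Conic Hausdorff metric. For nonzero $x,y$ put $\mathrm{dist}_s(x,y)=\arccos\big(\langle x,y\rangle/(\|x\|\|y\|)\big)$, with $\mathrm{dist}_s(0,0)=0$ and $\mathrm{dist}_s(x,0)=\mathrm{dist}_s(0,x)=\pi/2$ for $x\ne0$. Put $\mathcal{T}_s(C,\alpha)=\{x\in\mathbb{R}^d:\mathrm{dist}_s(x,y)\le\alpha\text{ for some }y\in C\}$. The conic Hausdorff metric on $\mathcal{C}_d$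 is $\mathrm{dist}_{\mathcal H}(C_1,C_2)=\inf\{\alpha\ge0:\mathcal{T}_s(C_1,\alpha)\supset C_2\text{ and }\mathcal{T}_s(C_2,\alpha)\supset C_1\}$. Conic intrinsic volumes. For polyhedral $C\in\mathcal{C}_d$ and $k=0,\dots,d$, $v_k(C)=\mathbb{P}\{\Pi_C(g)\text{ lies in the relative interior of a }k\text{-dimensional face of }C\}$, with $g$ a standard Gaussian vector in $\mathbb{R}^d$. For general $C\in\mathcal{C}_d$, $v_k(C)=\lim_{i\to\infty}v_k(C_i)$ for any sequence of polyhedral cones $C_i\in\mathcal{C}_d$ with $C_i\to C$ in the conic Hausdorff metric (polyhedral cones are dense, and the limit exists and does not depend on the sequence). The numbers $v_0(C),\dots,v_d(C)$ are nonnegative and sum to one. The intrinsic volume random variable $V_C$ has distribution $\mathbb{P}\{V_C=k\}=v_k(C)$ for $k=0,1,\dots,d$. The statistical dimension is $\delta(C):=\mathbb{E}[V_C]=\sum_{k=0}^d k\,v_k(C)$. *)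

theory Defs
  imports "HOL-Probability.Probability"
begin

(* convex_cone scales by all c \<ge> 0 and so forces 0 into the cone; for closed sets this
   agrees with the definition that only uses strictly positive scaling. *)
lemma closed_convex_cone_iff:
  fixes C :: "'a::euclidean_space set"
  assumes "closed C"
  shows "convex_cone C \<longleftrightarrow> C \<noteq> {} \<and> (\<forall>\<tau>>0. \<forall>x\<in>C. \<forall>y\<in>C. \<tau> *\<^sub>R (x + y) \<in> C)"
proof
  assume "convex_cone C"
  then show "C \<noteq> {} \<and> (\<forall>\<tau>>0. \<forall>x\<in>C. \<forall>y\<in>C. \<tau> *\<^sub>R (x + y) \<in> C)"
    by (auto simp: convex_cone_nonempty convex_cone_add convex_cone_scaleR)
next
  assume R: "C \<noteq> {} \<and> (\<forall>\<tau>>0. \<forall>x\<in>C. \<forall>y\<in>C. \<tau> *\<^sub>R (x + y) \<in> C)"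
  have add: "x + y \<in> C" if "x \<in> C" "y \<in> C" for x y
    using R that by (metis scaleR_one zero_less_one)
  have pos: "c *\<^sub>R x \<in> C" if "x \<in> C" "0 < c" for x c
  proof -
    have "(c / 2) *\<^sub>R (x + x) \<in> C"
      using R that by (meson half_gt_zero)
    then show ?thesis
      by (simp add: scaleR_2[symmetric])
  qed
  obtain x where x: "x \<in> C"
    using R by blast
  have "(\<lambda>n. inverse (real (Suc n)) *\<^sub>R x) \<longlonglongrightarrow> 0 *\<^sub>R x"
    by (intro tendsto_intros LIMSEQ_inverse_real_of_nat)
  then have "0 \<in> C"
    using closed_sequentially[OF assms, of "\<lambda>n. inverse (real (Suc n)) *\<^sub>R x"] pos[OF x] by simp
  then have "c *\<^sub>R x \<in> C" if "x \<in> C" "0 \<le> c" for x c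
    using pos[OF that(1)] that(2) by (cases "c = 0") auto
  then show "convex_cone C"
    using \<open>0 \<in> C\<close> add by (auto simp: convex_cone_iff)
qed

definition polar_cone :: "'a::euclidean_space set \<Rightarrow> 'a set"
  where "polar_cone C = {u. \<forall>x\<in>C. u \<bullet> x \<le> 0}"

definition polyhedral_cone :: "'a::euclidean_space set \<Rightarrow> bool"
  where "polyhedral_cone C \<longleftrightarrow> (\<exists>U. finite U \<and> C = (\<Inter>u\<in>U. {x. 0 \<le> u \<bullet> x}))"

definition cone_face :: "'a::euclidean_space set \<Rightarrow> 'a set \<Rightarrow> bool"
  where "cone_face C F \<longleftrightarrow> (\<exists>u\<in>polar_cone C. F = {x \<in> C. u \<bullet> x = (SUP y\<in>C. u \<bullet> y)})"

definition dist_s :: "'a::euclidean_space \<Rightarrow> 'a \<Rightarrow> real"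
  where "dist_s x y =
    (if x = 0 \<and> y = 0 then 0
     else if x = 0 \<or> y = 0 then pi / 2
     else arccos ((x \<bullet> y) / (norm x * norm y)))"

definition angular_nbhd :: "'a::euclidean_space set \<Rightarrow> real \<Rightarrow> 'a set"
  where "angular_nbhd C \<alpha> = {x. \<exists>y\<in>C. dist_s x y \<le> \<alpha>}"

definition conic_hausdist :: "'a::euclidean_space set \<Rightarrow> 'a set \<Rightarrow> real"
  where "conic_hausdist C\<^sub>1 C\<^sub>2 =
    Inf {\<alpha>. 0 \<le> \<alpha> \<and> C\<^sub>2 \<subseteq> angular_nbhd C\<^sub>1 \<alpha> \<and> C\<^sub>1 \<subseteq> angular_nbhd C\<^sub>2 \<alpha>}"

definition std_gaussian :: "'a::euclidean_space measure"
  where "std_gaussian = density lborel (\<lambda>x. ennreal (\<Prod>b\<in>Basis. std_normal_density (x \<bullet> b)))"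

(* A face contains 0, so its affine hull is its linear hull and rel_interior is the
   interior relative to the linear hull. *)
definition polyhedral_intrinsic_volume :: "'a::euclidean_space set \<Rightarrow> nat \<Rightarrow> real"
  where "polyhedral_intrinsic_volume C k =
    measure std_gaussian
      {g. \<exists>F. cone_face C F \<and> dim F = k \<and> closest_point C g \<in> rel_interior F}"

definition conic_intrinsic_volume :: "'a::euclidean_space set \<Rightarrow> nat \<Rightarrow> real"
  where "conic_intrinsic_volume C k =
    (if polyhedral_cone C then polyhedral_intrinsic_volume C k
     else THE v. \<forall>P. (\<forall>i. polyhedral_cone (P i)) \<and> (\<lambda>i. conic_hausdist (P i) C) \<longlonglongrightarrow> 0
                  \<longrightarrow> (\<lambda>i. polyhedral_intrinsic_volume (P i) k) \<longlonglongrightarrow> v)"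

(* The distribution of the random variable V_C; embed_pmf is meaningful here because the
   conic intrinsic volumes of a closed convex cone are nonnegative and sum to one. *)
definition intrinsic_volume_pmf :: "'a::euclidean_space set \<Rightarrow> nat pmf"
  where "intrinsic_volume_pmf C =
    embed_pmf (\<lambda>k. if k \<le> DIM('a) then conic_intrinsic_volume C k else 0)"

definition statistical_dimension :: "'a::euclidean_space set \<Rightarrow> real"
  where "statistical_dimension C = measure_pmf.expectation (intrinsic_volume_pmf C) real"

end

theory Submission
  imports Defs "HOL-Real_Asymp.Real_Asymp"
begin

text \<open>Write \<open>X\<close> for the squared norm of the projection of a Gaussian vector onto \<open>C\<close>. For a
  polyhedral cone, scaling along the span of a face and along its orthogonal complement gives the Steiner
  formula \<open>E exp (- t X / 2) = (\<Sum>k. v\<^sub>k (1 + t) powr (- k / 2))\<close>. The coefficients of a polynomial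
  depend continuously on its values, so the formula, and with it the existence of the limits defining the
  \<open>v\<^sub>k\<close>, passes to arbitrary closed convex cones; the projection onto the polar cone gives the same
  formula with the \<open>v\<^sub>k\<close> in reversed order. The gradient of \<open>X\<close> has squared norm \<open>4 X\<close>, so the
  Gaussian Poincare inequality for \<open>exp (- t X / 2)\<close> bounds \<open>G (2 t) - (G t)\<^sup>2\<close> by \<open>t (1 - G (2 t))\<close>,
  where \<open>G\<close> is the right hand side of the Steiner formula; comparing the terms of order \<open>t\<^sup>2\<close> as \<open>t\<close>
  tends to \<open>0\<close> yields the bound \<open>2 \<delta>(C)\<close> on the variance.\<close>

section \<open>The standard Gaussian measure\<close>

text \<open>The Steiner formula says that \<open>X\<close> is a chi-square variable with a random
  number \<open>V_C\<close> of degrees of freedom, since (1 + t) powr (- k / 2) is the corresponding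
  Laplace transform for fixed k. Hence E X = \<delta> and Var X = Var V_C + 2 \<delta>, while the
  Poincare inequality for \<open>X\<close> would read Var X \<le> 4 \<delta>; the difference is the
  constant 2. As \<open>X\<close> is unbounded and the inequality is proved for bounded Lipschitz
  functions, its Laplace transform takes its place, and the second moments come back as t tends to
  0. The Poincare inequality is obtained without differentiating a semigroup: rotating a pair of
  independent Gaussian vectors by a fixed angle gives an inequality in which no derivative occurs,
  and the gradient appears when the angle tends to 0. A further obstacle is that the intrinsic
  volumes of a cone that is not polyhedral are a \<open>THE\<close> of limits not yet known to
  exist. Everything about them is therefore read off from \<open>steiner_transform\<close>, which
  makes sense for every closed convex cone.\<close>

lemma std_gaussian_density_eq:
  fixes x :: "'a::euclidean_space"
  shows "(\<Prod>b\<in>Basis. std_normal_density (x \<bullet> b)) = (1 / sqrt (2 * pi)) ^ DIM('a) * exp (- (norm x)\<^sup>2 / 2)"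
proof -
  have "(\<Sum>b\<in>Basis. - (x \<bullet> b)\<^sup>2 / 2) = - (norm x)\<^sup>2 / 2"
    unfolding power2_norm_eq_inner euclidean_inner[of x x]
    by (simp add: power2_eq_square sum_negf sum_divide_distrib)
  then show ?thesis
    by (simp only: std_normal_density_def prod.distrib exp_sum[OF finite_Basis, symmetric] prod_constant)
qed

lemma sets_std_gaussian [simp, measurable_cong]: "sets std_gaussian = sets borel"
  and space_std_gaussian [simp]: "space std_gaussian = UNIV"
  by (simp_all add: std_gaussian_def)

lemma prob_space_std_gaussian: "prob_space (std_gaussian :: 'a::euclidean_space measure)"
proof
  have "(\<integral>\<^sup>+x. ennreal (std_normal_density x) \<partial>lborel) = 1"
    by (subst nn_integral_eq_integral) (auto intro: integrable_normal_density)
  then show "emeasure (std_gaussian :: 'a measure) (space std_gaussian) = 1"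
    by (simp add: std_gaussian_def emeasure_density prod_ennreal[symmetric]
        nn_integral_lborel_prod[of "\<lambda>_ x. ennreal (std_normal_density x)"])
qed

interpretation gaussian: prob_space std_gaussian
  by (rule prob_space_std_gaussian)

interpretation gaussian_pair: pair_prob_space std_gaussian std_gaussian ..

text \<open>The density depends on the norm alone, so it commutes with the passage to the image
  measure under \<open>T\<close>.\<close>

lemma distr_std_gaussian:
  fixes T :: "'a::euclidean_space \<Rightarrow> 'a"
  assumes [measurable]: "T \<in> borel_measurable borel"
    and T: "distr lborel borel T = lborel" and norm: "\<And>x. norm (T x) = norm x"
  shows "distr std_gaussian borel T = std_gaussian"
proof -
  have "std_gaussian = density (distr lborel borel T) (\<lambda>x::'a. ennreal (\<Prod>b\<in>Basis. std_normal_density (x \<bullet> b)))"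
    by (simp add: T std_gaussian_def)
  also have "\<dots> = distr std_gaussian borel T"
    by (subst density_distr) (auto simp: std_gaussian_def std_gaussian_density_eq norm)
  finally show ?thesis by simp
qed

lemma borel_measurable_orthogonal_transformation:
  fixes V :: "'a::euclidean_space \<Rightarrow> 'a"
  assumes "orthogonal_transformation V"
  shows "V \<in> borel_measurable borel"
  using assms by (intro borel_measurable_continuous_onI linear_continuous_on)
    (simp add: linear_conv_bounded_linear[symmetric] orthogonal_transformation_linear)

lemma nn_integral_lborel_translate:
  fixes f :: "'a::euclidean_space \<Rightarrow> ennreal"
  assumes [measurable]: "f \<in> borel_measurable borel"
  shows "(\<integral>\<^sup>+x. f (c + x) \<partial>lborel) = (\<integral>\<^sup>+x. f x \<partial>lborel)"
proof -
  have "(\<integral>\<^sup>+x. f x \<partial>lborel) = (\<integral>\<^sup>+x. f x \<partial>distr lborel borel ((+) c))"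
    by (simp only: lborel_distr_plus)
  also have "\<dots> = (\<integral>\<^sup>+x. f (c + x) \<partial>lborel)"
    by (subst nn_integral_distr) auto
  finally show ?thesis by simp
qed

text \<open>The image measure is translation invariant, hence a multiple of Lebesgue measure; the
  multiple is found by integrating the rotation invariant Gaussian density.\<close>

lemma lborel_distr_orthogonal:
  fixes V :: "'a::euclidean_space \<Rightarrow> 'a"
  assumes V: "orthogonal_transformation V"
  shows "distr lborel borel V = lborel"
proof (rule measure_eqI)
  note [measurable] = borel_measurable_orthogonal_transformation[OF V]
  define W where "W = inv V"
  have VW: "V (W x) = x" for x
    unfolding W_def using orthogonal_transformation_surj[OF V] by (rule surj_f_inv_f)
  define g :: "'a \<Rightarrow> ennreal" where "g x = ennreal (\<Prod>b\<in>Basis. std_normal_density (x \<bullet> b))" for x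
  have [measurable]: "g \<in> borel_measurable borel"
    unfolding g_def by measurable
  have g_norm: "g x = g y" if "norm x = norm y" for x y
    using that by (simp add: g_def std_gaussian_density_eq)
  have g_int: "(\<integral>\<^sup>+x. g x \<partial>lborel) = 1"
    using gaussian.emeasure_space_1[where 'a = 'a]
    by (simp add: std_gaussian_def emeasure_density g_def)
  fix A :: "'a set" assume "A \<in> sets (distr lborel borel V)"
  then have A[measurable]: "A \<in> sets borel" by simp
  \<comment> \<open>By linearity, adding y after \<open>V\<close> is the same as adding
    \<open>W y\<close> before it, and Lebesgue measure does not see that shift.\<close>
  have inv: "(\<integral>\<^sup>+x. h (V x + y) \<partial>lborel) = (\<integral>\<^sup>+x. h (V x) \<partial>lborel)"
    if [measurable]: "h \<in> borel_measurable borel" for h :: "'a \<Rightarrow> ennreal" and y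
  proof -
    have "V x + y = V (W y + x)" for x
      using linear_add[OF orthogonal_transformation_linear[OF V]] by (simp add: VW add.commute)
    then show ?thesis
      using nn_integral_lborel_translate[of "\<lambda>x. h (V x)" "W y"] by simp
  qed
  \<comment> \<open>One double integral is evaluated in two orders. With x innermost,
    \<open>inv\<close> removes y, and \<open>g\<close> has mass 1, which leaves the image measure of
    \<open>A\<close>.\<close>
  have "(\<integral>\<^sup>+y. \<integral>\<^sup>+x. indicator A (V x + y) * g y \<partial>lborel \<partial>lborel) =
      (\<integral>\<^sup>+y. (\<integral>\<^sup>+x. indicator A (V x) \<partial>lborel) * g y \<partial>lborel)"
    by (subst nn_integral_multc, simp, subst inv, simp_all)
  also have "\<dots> = (\<integral>\<^sup>+x. indicator A (V x) \<partial>lborel)"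
    by (subst nn_integral_cmult) (simp_all add: g_int)
  also have "\<dots> = emeasure (distr lborel borel V) A"
    using nn_integral_distr[of V lborel borel "indicator A"] by simp
  finally have 1: "(\<integral>\<^sup>+y. \<integral>\<^sup>+x. indicator A (V x + y) * g y \<partial>lborel \<partial>lborel) = emeasure (distr lborel borel V) A" .
  have "(\<integral>\<^sup>+y. \<integral>\<^sup>+x. indicator A (V x + y) * g y \<partial>lborel \<partial>lborel) =
      (\<integral>\<^sup>+x. \<integral>\<^sup>+y. indicator A (V x + y) * g y \<partial>lborel \<partial>lborel)"
    by (rule lborel_pair.Fubini') measurable
  also have "\<dots> = (\<integral>\<^sup>+x. \<integral>\<^sup>+y. indicator A y * g (y - V x) \<partial>lborel \<partial>lborel)"
  proof (rule nn_integral_cong)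
    fix x
    show "(\<integral>\<^sup>+y. indicator A (V x + y) * g y \<partial>lborel) = (\<integral>\<^sup>+y. indicator A y * g (y - V x) \<partial>lborel)"
      using nn_integral_lborel_translate[of "\<lambda>y. indicator A y * g (y - V x)" "V x"] by simp
  qed
  also have "\<dots> = (\<integral>\<^sup>+y. \<integral>\<^sup>+x. indicator A y * g (y - V x) \<partial>lborel \<partial>lborel)"
    by (rule lborel_pair.Fubini') measurable
  \<comment> \<open>In the other order the weight has become \<open>g (y - V x)\<close>. Its
    integral over x is 1 for every y, because \<open>g\<close> sees only norms; what remains is the
    Lebesgue measure of \<open>A\<close>.\<close>
  also have "\<dots> = (\<integral>\<^sup>+y. indicator A y \<partial>lborel)"
  proof (rule nn_integral_cong)
    fix y
    have "(\<integral>\<^sup>+x. g (y - V x) \<partial>lborel) = (\<integral>\<^sup>+x. g (V x + (- y)) \<partial>lborel)"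
      by (intro nn_integral_cong g_norm) (simp add: norm_minus_commute)
    also have "\<dots> = (\<integral>\<^sup>+x. g (V x) \<partial>lborel)"
      by (rule inv) simp
    also have "\<dots> = (\<integral>\<^sup>+x. g x \<partial>lborel)"
      by (intro nn_integral_cong g_norm) (simp add: orthogonal_transformation_norm V)
    finally show "(\<integral>\<^sup>+x. indicator A y * g (y - V x) \<partial>lborel) = indicator A y"
      by (subst nn_integral_cmult) (simp_all add: g_int)
  qed
  also have "\<dots> = emeasure lborel A"
    by simp
  finally show "emeasure (distr lborel borel V) A = emeasure lborel A"
    using 1 by simp
qed simp

lemma std_gaussian_distr_orthogonal:
  fixes V :: "'a::euclidean_space \<Rightarrow> 'a"
  assumes "orthogonal_transformation V"
  shows "distr std_gaussian borel V = std_gaussian"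
  using assms by (intro distr_std_gaussian)
    (auto simp: lborel_distr_orthogonal orthogonal_transformation_norm
       borel_measurable_orthogonal_transformation)

lemma nn_integral_std_gaussian_basis:
  fixes e :: "'a::euclidean_space"
  assumes e: "e \<in> Basis"
  shows "(\<integral>\<^sup>+x. ennreal ((x \<bullet> e)\<^sup>2) \<partial>std_gaussian) = 1"
proof -
  \<comment> \<open>The square is absorbed into the one-dimensional density at the coordinate
    \<open>e\<close>, so that the integrand is a product over the coordinates.\<close>
  define f where "f b x = std_normal_density x * (if b = e then x\<^sup>2 else 1)" for b :: 'a and x
  have int: "(\<integral>\<^sup>+x. ennreal (f b x) \<partial>lborel) = 1" for b
  proof (cases "b = e")
    case True
    have "has_bochner_integral lborel (\<lambda>x. std_normal_density x * x\<^sup>2) 1"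
      using std_normal_moment_even[of 1] by simp
    then show ?thesis
      unfolding f_def using True
      by (subst nn_integral_eq_integral) (auto simp: has_bochner_integral_iff)
  next
    case False
    then show ?thesis
      unfolding f_def by (subst nn_integral_eq_integral) (auto intro: integrable_normal_density)
  qed
  have prod: "(\<Prod>b\<in>Basis. std_normal_density (x \<bullet> b)) * (x \<bullet> e)\<^sup>2 = (\<Prod>b\<in>Basis. f b (x \<bullet> b))" for x :: 'a
    using e by (simp add: f_def prod.distrib prod.delta)
  have [measurable]: "f b \<in> borel_measurable borel" for b
    unfolding f_def by measurable
  have nn: "0 \<le> f b x" for b x
    by (simp add: f_def)
  have "(\<integral>\<^sup>+x. ennreal ((x \<bullet> e)\<^sup>2) \<partial>std_gaussian) = (\<integral>\<^sup>+x. ennreal (\<Prod>b\<in>Basis. f b (x \<bullet> b)) \<partial>lborel)"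
    unfolding std_gaussian_def
    by (subst nn_integral_density) (auto simp: prod[symmetric] ennreal_mult[symmetric] prod_nonneg)
  also have "\<dots> = (\<integral>\<^sup>+x. (\<Prod>b\<in>Basis. ennreal (f b (x \<bullet> b))) \<partial>lborel)"
    by (simp add: prod_ennreal nn)
  also have "\<dots> = 1"
    by (subst nn_integral_lborel_prod) (auto simp: nn int)
  finally show ?thesis .
qed

lemma integral_std_gaussian_basis:
  fixes e :: "'a::euclidean_space"
  assumes e: "e \<in> Basis"
  shows "integrable std_gaussian (\<lambda>x. (x \<bullet> e)\<^sup>2)" "(\<integral>x. (x \<bullet> e)\<^sup>2 \<partial>std_gaussian) = 1"
proof -
  show "integrable std_gaussian (\<lambda>x. (x \<bullet> e)\<^sup>2)"
    using nn_integral_std_gaussian_basis[OF e] by (intro integrableI_nonneg) auto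
  then show "(\<integral>x. (x \<bullet> e)\<^sup>2 \<partial>std_gaussian) = 1"
    using nn_integral_std_gaussian_basis[OF e]
    by (subst integral_eq_nn_integral) auto
qed

lemma integrable_std_gaussian_norm:
  "integrable std_gaussian (\<lambda>x::'a::euclidean_space. (norm x)\<^sup>2)"
  "integrable std_gaussian (\<lambda>x::'a::euclidean_space. norm x)"
proof -
  have "(norm x)\<^sup>2 = (\<Sum>b\<in>Basis. (x \<bullet> b)\<^sup>2)" for x :: 'a
    unfolding power2_norm_eq_inner euclidean_inner[of x x] by (simp add: power2_eq_square)
  then show sq: "integrable std_gaussian (\<lambda>x::'a. (norm x)\<^sup>2)"
    by (simp add: integral_std_gaussian_basis)
  have "norm x \<le> 1 + (norm x)\<^sup>2" for x :: 'a
    using sum_power2_ge_zero[of "norm x - 1/2" 0] by (simp add: power2_eq_square algebra_simps)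
  then have "AE x::'a in std_gaussian. norm (norm x) \<le> norm (1 + (norm x)\<^sup>2)"
    by (intro AE_I2) (simp add: abs_of_nonneg)
  then show "integrable std_gaussian (\<lambda>x::'a. norm x)"
    by (rule Bochner_Integration.integrable_bound[rotated 2]) (auto intro: sq)
qed

text \<open>Rotation invariance reduces the direction \<open>a\<close> to a multiple of one basis
  vector, whose coordinate has variance 1.\<close>

lemma std_gaussian_second_moment:
  fixes a :: "real^'n"
  shows "(\<integral>x. (a \<bullet> x)\<^sup>2 \<partial>std_gaussian) = (norm a)\<^sup>2"
proof -
  define e :: "real^'n" where "e = axis undefined 1"
  have e: "e \<in> Basis" "norm e = 1"
    by (auto simp: e_def)
  obtain V where V: "orthogonal_transformation V" "V (norm a *\<^sub>R e) = a"
    using orthogonal_transformation_exists[of "norm a *\<^sub>R e" a] e by auto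
  have [measurable]: "V \<in> borel_measurable borel"
    using V(1) by (rule borel_measurable_orthogonal_transformation)
  have "(\<integral>x. (a \<bullet> x)\<^sup>2 \<partial>std_gaussian) = (\<integral>x. (a \<bullet> x)\<^sup>2 \<partial>distr std_gaussian borel V)"
    using V(1) by (simp add: std_gaussian_distr_orthogonal)
  also have "\<dots> = (\<integral>x. (a \<bullet> V x)\<^sup>2 \<partial>std_gaussian)"
    by (subst integral_distr) auto
  also have "\<dots> = (\<integral>x. (norm a)\<^sup>2 * (x \<bullet> e)\<^sup>2 \<partial>std_gaussian)"
  proof (intro Bochner_Integration.integral_cong refl)
    fix x
    have "a \<bullet> V x = (norm a *\<^sub>R e) \<bullet> x"
      using V by (metis orthogonal_transformation_def)
    then show "(a \<bullet> V x)\<^sup>2 = (norm a)\<^sup>2 * (x \<bullet> e)\<^sup>2"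
      by (simp add: power_mult_distrib inner_commute)
  qed
  finally show ?thesis
    by (simp add: integral_std_gaussian_basis[OF e(1)])
qed

section \<open>Rotations of a pair of independent Gaussian vectors\<close>

text \<open>For fixed y the shear translates x by a constant, so Fubini and translation invariance
  suffice.\<close>

lemma lborel_pair_shear:
  fixes a :: real
  shows "distr (lborel \<Otimes>\<^sub>M lborel) (lborel \<Otimes>\<^sub>M lborel) (\<lambda>(x::'a::euclidean_space, y). (x + a *\<^sub>R y, y)) = lborel \<Otimes>\<^sub>M lborel" (is "distr ?M ?M ?S = _")
proof (rule measure_eqI)
  have S: "?S \<in> measurable ?M ?M"
    unfolding split_beta by measurable
  fix A assume "A \<in> sets (distr ?M ?M ?S)"
  then have A: "A \<in> sets ?M" by simp
  have inv: "(\<integral>\<^sup>+x. indicator A (x + c, y) \<partial>lborel) = (\<integral>\<^sup>+x. indicator A (x, y) \<partial>lborel)" for c y :: 'a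
  proof -
    have "(\<lambda>x. (x, y)) \<in> measurable lborel ?M"
      by (rule measurable_Pair) auto
    from measurable_compose[OF this borel_measurable_indicator[OF A]]
    have "(\<lambda>x. indicator A (x, y) :: ennreal) \<in> borel_measurable borel"
      by (simp only: measurable_lborel2)
    from nn_integral_lborel_translate[OF this, of c] show ?thesis
      by (simp only: add.commute[of c])
  qed
  note ind = borel_measurable_indicator[OF A]
  note ind' = measurable_compose[OF S ind]
  have "emeasure (distr ?M ?M ?S) A = (\<integral>\<^sup>+z. indicator A z \<partial>distr ?M ?M ?S)"
    using A by (intro nn_integral_indicator[symmetric]) simp
  also have "\<dots> = (\<integral>\<^sup>+z. indicator A (?S z) \<partial>?M)"
    using nn_integral_distr[OF S, of "indicator A"] ind by (simp only: measurable_distr_eq1)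
  also have "\<dots> = (\<integral>\<^sup>+y. \<integral>\<^sup>+x. indicator A (x + a *\<^sub>R y, y) \<partial>lborel \<partial>lborel)"
    using lborel_pair.nn_integral_snd[OF ind'] by (simp only: prod.case)
  also have "\<dots> = (\<integral>\<^sup>+z. indicator A z \<partial>?M)"
    unfolding inv by (rule lborel_pair.nn_integral_snd[OF ind])
  also have "\<dots> = emeasure ?M A"
    using A by (rule nn_integral_indicator)
  finally show "emeasure (distr ?M ?M ?S) A = emeasure ?M A" .
qed (rule sets_distr)

lemma measure_std_gaussian_UNIV [simp]: "measure std_gaussian UNIV = 1"
  using gaussian.prob_space by simp

lemma lborel_pair_shear':
  fixes a :: real
  shows "distr (lborel \<Otimes>\<^sub>M lborel) (lborel \<Otimes>\<^sub>M lborel) (\<lambda>(x::'a::euclidean_space, y). (x, y + a *\<^sub>R x)) = lborel \<Otimes>\<^sub>M lborel" (is "distr ?M ?M ?S = _")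
proof -
  let ?w = "\<lambda>(x::'a, y::'a). (y, x)" and ?T = "\<lambda>(x::'a, y). (x + a *\<^sub>R y, y)"
  have w: "?w \<in> measurable ?M ?M" and T: "?T \<in> measurable ?M ?M"
    unfolding split_beta by measurable
  have "?S = ?w \<circ> (?T \<circ> ?w)"
    by auto
  then have "distr ?M ?M ?S = distr (distr (distr ?M ?M ?w) ?M ?T) ?M ?w"
    using w T by (simp only: distr_distr measurable_comp)
  also have "\<dots> = ?M"
    by (simp only: lborel_pair.distr_pair_swap[symmetric] lborel_pair_shear)
  finally show ?thesis .
qed

text \<open>A plane rotation is a product of three shears, each of which preserves Lebesgue
  measure.\<close>

lemma lborel_pair_rotation:
  fixes c s :: real
  assumes cs: "c\<^sup>2 + s\<^sup>2 = 1" "s \<noteq> 0"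
  shows "distr (lborel \<Otimes>\<^sub>M lborel) (lborel \<Otimes>\<^sub>M lborel)
    (\<lambda>(x::'a::euclidean_space, y). (c *\<^sub>R x + s *\<^sub>R y, c *\<^sub>R y - s *\<^sub>R x)) = lborel \<Otimes>\<^sub>M lborel"
    (is "distr ?M ?M ?R = _")
proof -
  \<comment> \<open>For c = cos \<theta> and s = sin \<theta> this is tan (\<theta> / 2), the factor
    for which the composition of \<open>?S\<close>, \<open>?T\<close> and \<open>?S\<close> is the
    rotation.\<close>
  define a where "a = (1 - c) / s"
  let ?S = "\<lambda>(x::'a, y). (x + a *\<^sub>R y, y)" and ?T = "\<lambda>(x::'a, y). (x, y + (- s) *\<^sub>R x)"
  have S: "?S \<in> measurable ?M ?M" and T: "?T \<in> measurable ?M ?M"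
    unfolding split_beta by measurable
  have as: "a * s = 1 - c"
    using cs by (simp add: a_def)
  have "(a + a * c) * s = (1 + c) * (1 - c)"
    by (simp add: as[symmetric] algebra_simps)
  also have "\<dots> = s * s"
    using cs by (simp add: algebra_simps power2_eq_square)
  finally have ac: "a + a * c = s"
    using cs by simp
  have "?S (?T (?S (x, y))) = ?R (x, y)" for x y
  proof -
    have y: "y + (- s) *\<^sub>R (x + a *\<^sub>R y) = c *\<^sub>R y - s *\<^sub>R x"
    proof -
      have "(1 - a * s) *\<^sub>R y = c *\<^sub>R y"
        by (simp add: as)
      then show ?thesis
        by (simp add: algebra_simps)
    qed
    have "x + a *\<^sub>R y + a *\<^sub>R (c *\<^sub>R y - s *\<^sub>R x) = (1 - a * s) *\<^sub>R x + (a + a * c) *\<^sub>R y"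
      by (simp add: algebra_simps)
    also have "\<dots> = c *\<^sub>R x + s *\<^sub>R y"
      by (simp only: as ac) simp
    finally show ?thesis
      using y by simp
  qed
  then have "?R z = (?S \<circ> (?T \<circ> ?S)) z" for z
    by (cases z) (simp only: o_apply)
  then have "?R = ?S \<circ> (?T \<circ> ?S)"
    by (rule ext)
  then have "distr ?M ?M ?R = distr (distr (distr ?M ?M ?S) ?M ?T) ?M ?S"
    using S T by (simp only: distr_distr measurable_comp)
  also have "\<dots> = ?M"
    by (simp only: lborel_pair_shear lborel_pair_shear')
  finally show ?thesis .
qed

lemma std_gaussian_pair_density:
  "(std_gaussian :: 'a::euclidean_space measure) \<Otimes>\<^sub>M (std_gaussian :: 'a measure) = density (lborel \<Otimes>\<^sub>M lborel)
    (\<lambda>z. ennreal (((1 / sqrt (2 * pi)) ^ DIM('a))\<^sup>2 * exp (- ((norm (fst z))\<^sup>2 + (norm (snd z))\<^sup>2) / 2)))"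
proof -
  have "(std_gaussian :: 'a measure) \<Otimes>\<^sub>M (std_gaussian :: 'a measure) = density (lborel \<Otimes>\<^sub>M lborel)
    (\<lambda>(x, y). ennreal (\<Prod>b\<in>Basis. std_normal_density (x \<bullet> b)) * ennreal (\<Prod>b\<in>Basis. std_normal_density (y \<bullet> b)))"
    unfolding std_gaussian_def
    using prob_space_imp_sigma_finite[OF prob_space_std_gaussian[where 'a = 'a]]
    by (intro pair_measure_density) (simp_all add: lborel.sigma_finite_measure_axioms std_gaussian_def)
  also have "(\<lambda>(x::'a, y::'a). ennreal (\<Prod>b\<in>Basis. std_normal_density (x \<bullet> b)) * ennreal (\<Prod>b\<in>Basis. std_normal_density (y \<bullet> b)))
     = (\<lambda>z. ennreal (((1 / sqrt (2 * pi)) ^ DIM('a))\<^sup>2 * exp (- ((norm (fst z))\<^sup>2 + (norm (snd z))\<^sup>2) / 2)))"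
  proof (intro ext, clarify)
    fix x y :: 'a
    have "exp (- (norm x)\<^sup>2 / 2) * exp (- (norm y)\<^sup>2 / 2) = exp (- ((norm x)\<^sup>2 + (norm y)\<^sup>2) / 2)"
      by (simp add: exp_add[symmetric] add_divide_distrib)
    then show "ennreal (\<Prod>b\<in>Basis. std_normal_density (x \<bullet> b)) * ennreal (\<Prod>b\<in>Basis. std_normal_density (y \<bullet> b)) =
        ennreal (((1 / sqrt (2 * pi)) ^ DIM('a))\<^sup>2 * exp (- ((norm (fst (x, y)))\<^sup>2 + (norm (snd (x, y)))\<^sup>2) / 2))"
      by (simp add: std_gaussian_density_eq ennreal_mult[symmetric] power2_eq_square)
  qed
  finally show ?thesis .
qed

lemma std_gaussian_pair_rotation:
  fixes c s :: real
  assumes cs: "c\<^sup>2 + s\<^sup>2 = 1" "s \<noteq> 0"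
  shows "distr (std_gaussian \<Otimes>\<^sub>M std_gaussian) (borel \<Otimes>\<^sub>M borel)
    (\<lambda>(x::'a::euclidean_space, y). (c *\<^sub>R x + s *\<^sub>R y, c *\<^sub>R y - s *\<^sub>R x)) = std_gaussian \<Otimes>\<^sub>M std_gaussian"
    (is "distr _ _ ?R = _")
proof -
  let ?M = "lborel \<Otimes>\<^sub>M lborel :: ('a \<times> 'a) measure"
  let ?f = "\<lambda>z::'a \<times> 'a. ennreal (((1 / sqrt (2 * pi)) ^ DIM('a))\<^sup>2 * exp (- ((norm (fst z))\<^sup>2 + (norm (snd z))\<^sup>2) / 2))"
  have R: "?R \<in> measurable ?M ?M"
    unfolding split_beta by measurable
  have f: "?f \<in> borel_measurable ?M"
    by measurable
  have nrm: "(norm (c *\<^sub>R x + s *\<^sub>R y))\<^sup>2 + (norm (c *\<^sub>R y - s *\<^sub>R x))\<^sup>2 = (norm x)\<^sup>2 + (norm y)\<^sup>2" for x y :: 'a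
  proof -
    have "(norm (c *\<^sub>R x + s *\<^sub>R y))\<^sup>2 + (norm (c *\<^sub>R y - s *\<^sub>R x))\<^sup>2 = (c\<^sup>2 + s\<^sup>2) * ((norm x)\<^sup>2 + (norm y)\<^sup>2)"
      unfolding power2_norm_eq_inner by (simp add: algebra_simps inner_commute power2_eq_square)
    then show ?thesis using cs by simp
  qed
  have fR: "?f (?R z) = ?f z" for z
    by (cases z) (simp only: prod.case fst_conv snd_conv nrm)
  have "distr (std_gaussian \<Otimes>\<^sub>M std_gaussian) (borel \<Otimes>\<^sub>M borel) ?R = distr (density ?M ?f) ?M ?R"
    unfolding std_gaussian_pair_density by (intro distr_cong sets_pair_measure_cong refl) simp_all
  also have "\<dots> = distr (density ?M (\<lambda>z. ?f (?R z))) ?M ?R"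
    by (simp only: fR)
  also have "\<dots> = density (distr ?M ?M ?R) ?f"
    using R f by (rule density_distr[symmetric, rotated])
  also have "\<dots> = std_gaussian \<Otimes>\<^sub>M std_gaussian"
    by (simp only: lborel_pair_rotation[OF cs] std_gaussian_pair_density)
  finally show ?thesis .
qed

lemma integral_std_gaussian_rotation:
  fixes F :: "'a::euclidean_space \<Rightarrow> 'a \<Rightarrow> real"
  assumes cs: "c\<^sup>2 + s\<^sup>2 = 1" "s \<noteq> 0"
    and F[measurable]: "case_prod F \<in> borel_measurable (borel \<Otimes>\<^sub>M borel)"
    and B: "\<And>x y. \<bar>F x y\<bar> \<le> B"
  shows "(\<integral>x. \<integral>y. F (c *\<^sub>R x + s *\<^sub>R y) (c *\<^sub>R y - s *\<^sub>R x) \<partial>std_gaussian \<partial>std_gaussian)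
     = (\<integral>x. \<integral>y. F x y \<partial>std_gaussian \<partial>std_gaussian)"
proof -
  let ?G = "std_gaussian \<Otimes>\<^sub>M std_gaussian :: ('a \<times> 'a) measure"
  let ?R = "\<lambda>(x::'a, y). (c *\<^sub>R x + s *\<^sub>R y, c *\<^sub>R y - s *\<^sub>R x)"
  have R[measurable]: "?R \<in> measurable ?G (borel \<Otimes>\<^sub>M borel)"
    unfolding split_beta by measurable
  have m: "case_prod F \<in> borel_measurable ?G"
    by measurable
  have int: "integrable ?G (case_prod F)"
    using m by (rule gaussian_pair.P.integrable_const_bound[where B = B, rotated]) (auto simp: B)
  have intR: "integrable ?G (\<lambda>z. case_prod F (?R z))"
    by (rule gaussian_pair.P.integrable_const_bound[where B = B]) (auto simp: B split_beta)
  have "(\<integral>x. \<integral>y. F (c *\<^sub>R x + s *\<^sub>R y) (c *\<^sub>R y - s *\<^sub>R x) \<partial>std_gaussian \<partial>std_gaussian) = (\<integral>z. case_prod F (?R z) \<partial>?G)"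
    using gaussian_pair.integral_fst'[OF intR] by simp
  also have "\<dots> = (\<integral>z. case_prod F z \<partial>distr ?G (borel \<Otimes>\<^sub>M borel) ?R)"
    by (rule integral_distr[symmetric]) measurable
  also have "\<dots> = (\<integral>z. case_prod F z \<partial>?G)"
    by (simp only: std_gaussian_pair_rotation[OF cs])
  also have "\<dots> = (\<integral>x. \<integral>y. F x y \<partial>std_gaussian \<partial>std_gaussian)"
    using gaussian_pair.integral_fst'[OF int] by simp
  finally show ?thesis .
qed

text \<open>Stability of the Gaussian law: for independent x and y the combination with coefficients
  a and b is distributed as q times x. It is the rotation with cosine a / q and sine b / q, applied
  to an integrand that ignores its second argument.\<close>

lemma integral_std_gaussian_combination:
  fixes h :: "'a::euclidean_space \<Rightarrow> real"
  assumes ab: "a\<^sup>2 + b\<^sup>2 = q\<^sup>2" "0 < q" "b \<noteq> 0"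
    and h[measurable]: "h \<in> borel_measurable borel" and B: "\<And>x. \<bar>h x\<bar> \<le> B"
  shows "(\<integral>x. \<integral>y. h (a *\<^sub>R x + b *\<^sub>R y) \<partial>std_gaussian \<partial>std_gaussian) = (\<integral>x. h (q *\<^sub>R x) \<partial>std_gaussian)"
proof -
  have "(a / q)\<^sup>2 + (b / q)\<^sup>2 = 1" "b / q \<noteq> 0"
    using ab by (auto simp: power_divide add_divide_distrib[symmetric])
  from integral_std_gaussian_rotation[OF this, of "\<lambda>x y. h (q *\<^sub>R x)" B]
  show ?thesis
    using ab B by (simp add: scaleR_add_right measure_std_gaussian_UNIV)
qed

section \<open>The Gaussian Poincare inequality\<close>

lemma discriminant_le_of_nonneg:
  fixes a b c :: real
  assumes q: "\<And>t. 0 \<le> a + 2 * t * b + t\<^sup>2 * c" and c: "0 \<le> c"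
  shows "b\<^sup>2 \<le> a * c"
proof (cases "c = 0")
  case True
  have "b = 0"
  proof (rule ccontr)
    assume "b \<noteq> 0"
    \<comment> \<open>For c = 0 the expression is affine in t, and the chosen t gives it the value
      -1.\<close>
    then show False
      using q[of "- (a + 1) / (2 * b)"] True by (simp add: field_simps)
  qed
  then show ?thesis using True by simp
next
  case False
  then have c: "0 < c" using c by simp
  have "a + 2 * (- b / c) * b + (- b / c)\<^sup>2 * c = a - b\<^sup>2 / c"
    using c by (simp add: power2_eq_square)
  then have "b\<^sup>2 / c \<le> a"
    using q[of "- b / c"] by simp
  then show ?thesis
    using c by (simp add: field_simps)
qed

text \<open>Cauchy-Schwarz, from the discriminant of the nonnegative quadratic t \<mapsto> E (f + t
  g)^2.\<close>

lemma (in prob_space) integral_mult_power2_le: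
  fixes f g :: "'a \<Rightarrow> real"
  assumes [measurable]: "f \<in> borel_measurable M" "g \<in> borel_measurable M"
    and f: "\<And>x. \<bar>f x\<bar> \<le> A" and g: "\<And>x. \<bar>g x\<bar> \<le> B"
  shows "(\<integral>x. f x * g x \<partial>M)\<^sup>2 \<le> (\<integral>x. (f x)\<^sup>2 \<partial>M) * (\<integral>x. (g x)\<^sup>2 \<partial>M)"
proof -
  have B0: "0 \<le> B" and A0: "0 \<le> A"
    using f[of undefined] g[of undefined] by auto
  have int: "integrable M (\<lambda>x. (f x)\<^sup>2)" "integrable M (\<lambda>x. (g x)\<^sup>2)" "integrable M (\<lambda>x. f x * g x)"
    by (intro integrable_const_bound[of _ "A\<^sup>2"] integrable_const_bound[of _ "B\<^sup>2"] integrable_const_bound[of _ "A * B"] AE_I2;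
        auto simp: abs_mult A0 B0 intro!: mult_mono f g power_mono abs_le_square_iff[THEN iffD1] order_trans[OF f] order_trans[OF g])+
  let ?a = "\<integral>x. (f x)\<^sup>2 \<partial>M" and ?b = "\<integral>x. f x * g x \<partial>M" and ?c = "\<integral>x. (g x)\<^sup>2 \<partial>M"
  have "0 \<le> ?a + 2 * t * ?b + t\<^sup>2 * ?c" for t
  proof -
    have "0 \<le> (\<integral>x. (f x + t * g x)\<^sup>2 \<partial>M)"
      by simp
    also have "(\<lambda>x. (f x + t * g x)\<^sup>2) = (\<lambda>x. (f x)\<^sup>2 + (2 * t) * (f x * g x) + t\<^sup>2 * (g x)\<^sup>2)"
      by (auto simp: power2_eq_square algebra_simps)
    finally show ?thesis
      using int by simp
  qed
  then show ?thesis
    by (rule discriminant_le_of_nonneg) simp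
qed

section \<open>The Ornstein-Uhlenbeck semigroup\<close>

text \<open>Mehler's formula for the Ornstein-Uhlenbeck semigroup at the time \<tau> with r = exp (-
  \<tau>). In this parametrisation composing operators multiplies the parameters.\<close>

definition ornstein_uhlenbeck :: "real \<Rightarrow> ('a::euclidean_space \<Rightarrow> real) \<Rightarrow> 'a \<Rightarrow> real" where
  "ornstein_uhlenbeck r f x = (\<integral>y. f (r *\<^sub>R x + sqrt (1 - r\<^sup>2) *\<^sub>R y) \<partial>std_gaussian)"

lemma measurable_ornstein_uhlenbeck [measurable]:
  assumes [measurable]: "f \<in> borel_measurable borel"
  shows "ornstein_uhlenbeck r f \<in> borel_measurable borel"
proof -
  have "(\<lambda>(x, y). f (r *\<^sub>R x + sqrt (1 - r\<^sup>2) *\<^sub>R y)) \<in> borel_measurable (borel \<Otimes>\<^sub>M std_gaussian)"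
    unfolding split_beta by measurable
  from gaussian.borel_measurable_lebesgue_integral[OF this] show ?thesis
    unfolding ornstein_uhlenbeck_def .
qed

lemma (in prob_space) abs_integral_le_const:
  fixes f :: "'a \<Rightarrow> real"
  assumes "f \<in> borel_measurable M" "\<And>x. \<bar>f x\<bar> \<le> B"
  shows "\<bar>\<integral>x. f x \<partial>M\<bar> \<le> B"
proof -
  have "integrable M f"
    using assms by (intro integrable_const_bound[of _ B]) auto
  moreover have "f x \<le> B" "- B \<le> f x" for x
    using assms(2)[of x] by auto
  ultimately have "(\<integral>x. f x \<partial>M) \<le> B" "- B \<le> (\<integral>x. f x \<partial>M)"
    by (auto intro!: integral_le_const integral_ge_const)
  then show ?thesis by auto
qed

lemma abs_ornstein_uhlenbeck_le:
  assumes [measurable]: "f \<in> borel_measurable borel" and "\<And>x. \<bar>f x\<bar> \<le> B"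
  shows "\<bar>ornstein_uhlenbeck r f x\<bar> \<le> B"
  unfolding ornstein_uhlenbeck_def using assms by (intro gaussian.abs_integral_le_const) auto

text \<open>This combines symmetry and the semigroup law: the pairing of P_r f with itself is the
  pairing of f with P_r (P_r f). Symmetry comes from the rotation (x, y) \<mapsto> (u, w) that makes
  u = r x + s y the argument of f.\<close>

lemma ornstein_uhlenbeck_semigroup:
  fixes f :: "'a::euclidean_space \<Rightarrow> real"
  assumes r: "0 < r" "r < 1" and f[measurable]: "f \<in> borel_measurable borel" and B: "\<And>x. \<bar>f x\<bar> \<le> B"
  shows "(\<integral>x. (ornstein_uhlenbeck r f x)\<^sup>2 \<partial>std_gaussian) = (\<integral>x. f x * ornstein_uhlenbeck (r\<^sup>2) f x \<partial>std_gaussian)"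
proof -
  define s where "s = sqrt (1 - r\<^sup>2)"
  have r2: "r\<^sup>2 < 1"
    using r by (simp add: power_less_one_iff)
  then have s: "r\<^sup>2 + s\<^sup>2 = 1" "s \<noteq> 0" "0 < s"
    by (auto simp: s_def)
  have r4: "(r\<^sup>2)\<^sup>2 < 1"
    using r2 r by (simp add: power_less_one_iff)
  \<comment> \<open>The standard deviation of the noise accumulated in two steps: the first noise is
    damped by r, and r^2 s^2 + s^2 = 1 - r^4.\<close>
  define q where "q = sqrt (1 - (r\<^sup>2)\<^sup>2)"
  have q: "(- (r * s))\<^sup>2 + s\<^sup>2 = q\<^sup>2" "0 < q"
  proof -
    have s2: "s\<^sup>2 = 1 - r\<^sup>2" using s by simp
    have "(- (r * s))\<^sup>2 + s\<^sup>2 = 1 - (r\<^sup>2)\<^sup>2"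
      unfolding power2_minus power_mult_distrib s2 by (simp add: algebra_simps power2_eq_square)
    then show "(- (r * s))\<^sup>2 + s\<^sup>2 = q\<^sup>2"
      using r4 by (simp add: q_def)
  qed (use r4 in \<open>simp add: q_def\<close>)
  have B0: "0 \<le> B" using B[of 0] by simp
  have ouB: "\<bar>ornstein_uhlenbeck r f x\<bar> \<le> B" for x
    by (rule abs_ornstein_uhlenbeck_le) (auto simp: B)
  \<comment> \<open>The integrand in rotated coordinates; \<open>rot_back\<close> below recovers the
    original point as x = r u - s w.\<close>
  define F where "F u w = f u * ornstein_uhlenbeck r f (r *\<^sub>R u - s *\<^sub>R w)" for u w
  have Fm: "case_prod F \<in> borel_measurable (borel \<Otimes>\<^sub>M borel)"
    unfolding F_def split_beta by measurable
  have FB: "\<bar>F u w\<bar> \<le> B * B" for u w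
    unfolding F_def abs_mult by (intro mult_mono B ouB) (auto simp: B0)
  have rot_back: "r *\<^sub>R (r *\<^sub>R x + s *\<^sub>R y) - s *\<^sub>R (r *\<^sub>R y - s *\<^sub>R x) = x" for x y :: 'a
  proof -
    have "r *\<^sub>R (r *\<^sub>R x + s *\<^sub>R y) - s *\<^sub>R (r *\<^sub>R y - s *\<^sub>R x) = (r\<^sup>2 + s\<^sup>2) *\<^sub>R x"
      by (simp add: algebra_simps power2_eq_square)
    then show ?thesis by (simp add: s)
  qed
  have inner: "(\<integral>w. ornstein_uhlenbeck r f (r *\<^sub>R u - s *\<^sub>R w) \<partial>std_gaussian) = ornstein_uhlenbeck (r\<^sup>2) f u" for u
  proof -
    have "(\<integral>w. ornstein_uhlenbeck r f (r *\<^sub>R u - s *\<^sub>R w) \<partial>std_gaussian)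
        = (\<integral>w. \<integral>y. f (r\<^sup>2 *\<^sub>R u + ((- (r * s)) *\<^sub>R w + s *\<^sub>R y)) \<partial>std_gaussian \<partial>std_gaussian)"
      unfolding ornstein_uhlenbeck_def s_def[symmetric]
      by (simp add: algebra_simps power2_eq_square)
    also have "\<dots> = (\<integral>y. f (r\<^sup>2 *\<^sub>R u + q *\<^sub>R y) \<partial>std_gaussian)"
      by (rule integral_std_gaussian_combination[OF q(1,2) s(2), where h = "\<lambda>v. f (r\<^sup>2 *\<^sub>R u + v)" and B = B])
         (auto simp: B)
    finally show ?thesis
      by (simp add: ornstein_uhlenbeck_def q_def)
  qed
  have "(\<integral>x. (ornstein_uhlenbeck r f x)\<^sup>2 \<partial>std_gaussian)
      = (\<integral>x. \<integral>y. F (r *\<^sub>R x + s *\<^sub>R y) (r *\<^sub>R y - s *\<^sub>R x) \<partial>std_gaussian \<partial>std_gaussian)"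
  proof (intro Bochner_Integration.integral_cong refl)
    fix x
    have "(ornstein_uhlenbeck r f x)\<^sup>2 = (\<integral>y. f (r *\<^sub>R x + s *\<^sub>R y) \<partial>std_gaussian) * ornstein_uhlenbeck r f x"
      by (simp add: ornstein_uhlenbeck_def s_def power2_eq_square)
    then show "(ornstein_uhlenbeck r f x)\<^sup>2 = (\<integral>y. F (r *\<^sub>R x + s *\<^sub>R y) (r *\<^sub>R y - s *\<^sub>R x) \<partial>std_gaussian)"
      by (simp add: F_def rot_back)
  qed
  also have "\<dots> = (\<integral>u. \<integral>w. F u w \<partial>std_gaussian \<partial>std_gaussian)"
    by (rule integral_std_gaussian_rotation[OF s(1,2) Fm FB])
  also have "\<dots> = (\<integral>x. f x * ornstein_uhlenbeck (r\<^sup>2) f x \<partial>std_gaussian)"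
    by (simp add: F_def inner)
  finally show ?thesis .
qed

text \<open>If \<open>\<phi> r > r A\<close>, then \<open>\<psi> r = \<phi> r / (r A) > 1\<close> satisfies \<open>\<psi> r\<^sup>2 \<le> \<psi> (r\<^sup>2)\<close>, so that \<open>\<psi>\<close> is
  unbounded near \<open>0\<close>.\<close>

lemma le_linear_of_power2_le:
  fixes \<phi> :: "real \<Rightarrow> real"
  assumes sq: "\<And>r. 0 < r \<Longrightarrow> r < 1 \<Longrightarrow> (\<phi> r)\<^sup>2 \<le> A * \<phi> (r\<^sup>2)"
    and lin: "\<And>r. 0 < r \<Longrightarrow> r < 1 \<Longrightarrow> \<phi> r \<le> K * r"
    and A: "0 \<le> A" and r: "0 < r" "r < 1"
  shows "\<phi> r \<le> r * A"
proof (cases "A = 0")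
  case True
  then show ?thesis using sq[OF r] by simp
next
  case False
  then have A: "0 < A" using A by simp
  show ?thesis
  proof (rule ccontr)
    assume "\<not> \<phi> r \<le> r * A"
    define \<psi> where "\<psi> r = \<phi> r / (r * A)" for r
    have \<psi>: "(\<psi> x)\<^sup>2 \<le> \<psi> (x\<^sup>2)" if "0 < x" "x < 1" for x
    proof -
      have "(\<psi> x)\<^sup>2 = (\<phi> x)\<^sup>2 / (x\<^sup>2 * A\<^sup>2)"
        by (simp add: \<psi>_def power_divide power_mult_distrib)
      also have "\<dots> \<le> A * \<phi> (x\<^sup>2) / (x\<^sup>2 * A\<^sup>2)"
        using sq[OF that] by (rule divide_right_mono) simp
      also have "\<dots> = \<psi> (x\<^sup>2)"
        using A by (simp add: \<psi>_def power2_eq_square)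
      finally show ?thesis .
    qed
    have \<psi>r: "1 < \<psi> r"
      using \<open>\<not> \<phi> r \<le> r * A\<close> r A by (simp add: \<psi>_def)
    have rn: "0 < r ^ 2 ^ n" "r ^ 2 ^ n < 1" for n :: nat
      using r by (auto simp: power_less_one_iff)
    have pow: "\<psi> r ^ 2 ^ n \<le> \<psi> (r ^ 2 ^ n)" for n
    proof (induction n)
      case (Suc n)
      have "\<psi> r ^ 2 ^ Suc n = (\<psi> r ^ 2 ^ n)\<^sup>2"
        by (simp add: power_mult[symmetric] mult.commute)
      also have "\<dots> \<le> (\<psi> (r ^ 2 ^ n))\<^sup>2"
        using Suc.IH \<psi>r by (intro power_mono) auto
      also have "\<dots> \<le> \<psi> ((r ^ 2 ^ n)\<^sup>2)"
        by (rule \<psi>[OF rn])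
      also have "(r ^ 2 ^ n)\<^sup>2 = r ^ 2 ^ Suc n"
        by (simp add: power_mult[symmetric] mult.commute)
      finally show ?case .
    qed simp
    \<comment> \<open>The linear bound on \<open>\<phi>\<close> caps \<open>\<psi>\<close> on all of
      (0, 1), which the growth along the iterated squares of r contradicts.\<close>
    have bound: "\<psi> x \<le> K / A" if "0 < x" "x < 1" for x
      using lin[OF that] that A by (simp add: \<psi>_def field_simps)
    obtain n where n: "K / A < \<psi> r ^ n"
      using real_arch_pow[OF \<psi>r] by blast
    also have "\<dots> \<le> \<psi> r ^ 2 ^ n"
      using \<psi>r by (intro power_increasing) (auto intro: less_imp_le)
    also have "\<dots> \<le> K / A"
      using pow[of n] bound[OF rn(1,2), of n] by linarith
    finally show False by simp
  qed
qed

text \<open>By the semigroup property and the Cauchy-Schwarz inequality, the correlation \<open>\<phi> r\<close> of \<open>f\<close> with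
  \<open>ornstein_uhlenbeck r f\<close> satisfies \<open>(\<phi> r)\<^sup>2 \<le> \<phi> 1 * \<phi> (r\<^sup>2)\<close>; the Lipschitz bound makes it \<open>O(r)\<close>.\<close>

lemma ornstein_uhlenbeck_spectral_gap:
  fixes f :: "'a::euclidean_space \<Rightarrow> real"
  assumes r: "0 < r" "r < 1" and f[measurable]: "f \<in> borel_measurable borel" and B: "\<And>x. \<bar>f x\<bar> \<le> B"
    and lip: "\<And>x y. \<bar>f x - f y\<bar> \<le> L * norm (x - y)"
    and mean: "(\<integral>x. f x \<partial>std_gaussian) = 0"
  shows "(\<integral>x. f x * ornstein_uhlenbeck r f x \<partial>std_gaussian) \<le> r * (\<integral>x. (f x)\<^sup>2 \<partial>std_gaussian)"
proof (rule le_linear_of_power2_le[where K = "B * L * (\<integral>x. norm (x::'a) \<partial>std_gaussian)" and r = r, OF _ _ _ r])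
  show "0 \<le> (\<integral>x. (f x)\<^sup>2 \<partial>std_gaussian)" by simp
  fix t :: real assume t: "0 < t" "t < 1"
  have ouB: "\<bar>ornstein_uhlenbeck t f x\<bar> \<le> B" for x
    by (rule abs_ornstein_uhlenbeck_le) (auto simp: B)
  have B0: "0 \<le> B" using B[of 0] by simp
  have [simp]: "f \<in> borel_measurable std_gaussian"
    by measurable
  show "(\<integral>x. f x * ornstein_uhlenbeck t f x \<partial>std_gaussian)\<^sup>2 \<le>
      (\<integral>x. (f x)\<^sup>2 \<partial>std_gaussian) * (\<integral>x. f x * ornstein_uhlenbeck (t\<^sup>2) f x \<partial>std_gaussian)"
    unfolding ornstein_uhlenbeck_semigroup[OF t f B, symmetric]
    by (rule gaussian.integral_mult_power2_le[where A = B and B = B]) (auto simp: B ouB)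
  define s where "s = sqrt (1 - t\<^sup>2)"
  \<comment> \<open>This is the value of \<open>ornstein_uhlenbeck t f\<close> at 0. Subtracting it
    does not change the correlation because f has mean 0, and the Lipschitz bound controls the
    difference by L t |x|.\<close>
  define m where "m = (\<integral>y. f (s *\<^sub>R y) \<partial>std_gaussian)"
  have intf: "integrable std_gaussian f"
    by (rule gaussian.integrable_const_bound[of _ B]) (auto simp: B)
  have "\<bar>ornstein_uhlenbeck t f x - m\<bar> \<le> L * t * norm x" for x
  proof -
    have i: "integrable std_gaussian (\<lambda>y. f (c *\<^sub>R x + s *\<^sub>R y))" for c
      by (rule gaussian.integrable_const_bound[of _ B]) (auto simp: B)
    have "ornstein_uhlenbeck t f x - m = (\<integral>y. f (t *\<^sub>R x + s *\<^sub>R y) - f (s *\<^sub>R y) \<partial>std_gaussian)"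
      using i[of t] i[of 0] by (simp add: ornstein_uhlenbeck_def s_def m_def)
    moreover have "\<bar>\<integral>y. f (t *\<^sub>R x + s *\<^sub>R y) - f (s *\<^sub>R y) \<partial>std_gaussian\<bar> \<le> L * t * norm x"
    proof (rule gaussian.abs_integral_le_const)
      fix y show "\<bar>f (t *\<^sub>R x + s *\<^sub>R y) - f (s *\<^sub>R y)\<bar> \<le> L * t * norm x"
        using lip[of "t *\<^sub>R x + s *\<^sub>R y" "s *\<^sub>R y"] t by simp
    qed measurable
    ultimately show ?thesis by simp
  qed
  note ou = this
  have "0 \<le> L"
  proof -
    obtain b :: 'a where "b \<in> Basis" using nonempty_Basis by blast
    then show ?thesis
      using lip[of b 0] by simp
  qed
  have "(\<integral>x. f x * ornstein_uhlenbeck t f x \<partial>std_gaussian) = (\<integral>x. f x * (ornstein_uhlenbeck t f x - m) \<partial>std_gaussian)"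
  proof -
    have "integrable std_gaussian (\<lambda>x. f x * ornstein_uhlenbeck t f x)"
      by (rule gaussian.integrable_const_bound[of _ "B * B"]) (auto simp: abs_mult B0 intro!: mult_mono B ouB)
    then show ?thesis
      using intf by (simp add: right_diff_distrib mean)
  qed
  also have "\<dots> \<le> (\<integral>x. B * (L * t * norm (x::'a)) \<partial>std_gaussian)"
  proof (rule Bochner_Integration.integral_mono')
    show "integrable std_gaussian (\<lambda>x::'a. B * (L * t * norm x))"
      by (intro integrable_mult_right integrable_std_gaussian_norm)
    fix x
    have "f x * (ornstein_uhlenbeck t f x - m) \<le> \<bar>f x\<bar> * \<bar>ornstein_uhlenbeck t f x - m\<bar>"
      by (simp add: abs_mult[symmetric])
    also have "\<dots> \<le> B * (L * t * norm x)"
      by (intro mult_mono B ou) (auto simp: B0)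
    finally show "f x * (ornstein_uhlenbeck t f x - m) \<le> B * (L * t * norm x)" .
    show "0 \<le> B * (L * t * norm x)"
      using B0 t \<open>0 \<le> L\<close> by simp
  qed
  finally show "(\<integral>x. f x * ornstein_uhlenbeck t f x \<partial>std_gaussian) \<le> B * L * (\<integral>x. norm (x::'a) \<partial>std_gaussian) * t"
    by (simp add: mult_ac)
qed

text \<open>A derivative-free form of the Poincare inequality. Expanding the square, the two pure
  terms both integrate to E f^2 by invariance, and the spectral gap bounds the cross term by cos
  \<theta> times E f^2.\<close>

lemma std_gaussian_variance_le_rotation:
  fixes f :: "'a::euclidean_space \<Rightarrow> real"
  assumes \<theta>: "0 < \<theta>" "\<theta> < pi / 2" and f[measurable]: "f \<in> borel_measurable borel" and B: "\<And>x. \<bar>f x\<bar> \<le> B"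
    and lip: "\<And>x y. \<bar>f x - f y\<bar> \<le> L * norm (x - y)"
    and mean: "(\<integral>x. f x \<partial>std_gaussian) = 0"
  shows "2 * (1 - cos \<theta>) * (\<integral>x. (f x)\<^sup>2 \<partial>std_gaussian)
    \<le> (\<integral>x. \<integral>y. (f (cos \<theta> *\<^sub>R x + sin \<theta> *\<^sub>R y) - f x)\<^sup>2 \<partial>std_gaussian \<partial>std_gaussian)"
proof -
  define r s where "r = cos \<theta>" and "s = sin \<theta>"
  have r: "0 < r" "r < 1"
    using \<theta> cos_gt_zero[of \<theta>] cos_monotone_0_pi[of 0 \<theta>] by (auto simp: r_def)
  have s: "0 < s" "r\<^sup>2 + s\<^sup>2 = 1\<^sup>2"
    using \<theta> sin_gt_zero[of \<theta>] by (auto simp: r_def s_def)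
  have s_eq: "s = sqrt (1 - r\<^sup>2)"
    using s by (simp add: real_sqrt_unique[symmetric] algebra_simps)
  have B0: "0 \<le> B" using B[of 0] by simp
  have fB: "\<bar>f x * f y\<bar> \<le> B * B" for x y
    unfolding abs_mult by (intro mult_mono B) (auto simp: B0)
  have ouB: "\<bar>ornstein_uhlenbeck r f x\<bar> \<le> B" for x
    by (rule abs_ornstein_uhlenbeck_le) (auto simp: B)
  have sqB: "(f x)\<^sup>2 \<le> B * B" for x
    using fB[of x x] by (simp add: power2_eq_square)
  have i1: "integrable std_gaussian (\<lambda>y. (f (r *\<^sub>R x + s *\<^sub>R y))\<^sup>2)"
    and i2: "integrable std_gaussian (\<lambda>y. f (r *\<^sub>R x + s *\<^sub>R y))" for x
    by (rule gaussian.integrable_const_bound[of _ "B * B"] gaussian.integrable_const_bound[of _ B]; auto simp: sqB B)+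
  define T where "T x = (\<integral>y. (f (r *\<^sub>R x + s *\<^sub>R y))\<^sup>2 \<partial>std_gaussian)" for x
  have [measurable]: "T \<in> borel_measurable borel"
  proof -
    have "(\<lambda>(x, y). (f (r *\<^sub>R x + s *\<^sub>R y))\<^sup>2) \<in> borel_measurable (borel \<Otimes>\<^sub>M std_gaussian)"
      unfolding split_beta by measurable
    from gaussian.borel_measurable_lebesgue_integral[OF this] show ?thesis
      unfolding T_def .
  qed
  have TB: "\<bar>T x\<bar> \<le> B * B" for x
    unfolding T_def by (intro gaussian.abs_integral_le_const) (auto simp: sqB)
  have "(\<integral>y. (f (r *\<^sub>R x + s *\<^sub>R y) - f x)\<^sup>2 \<partial>std_gaussian) = T x - 2 * (f x * ornstein_uhlenbeck r f x) + (f x)\<^sup>2" for x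
  proof -
    have "(\<integral>y. (f (r *\<^sub>R x + s *\<^sub>R y) - f x)\<^sup>2 \<partial>std_gaussian)
      = (\<integral>y. (f (r *\<^sub>R x + s *\<^sub>R y))\<^sup>2 - (2 * f x) * f (r *\<^sub>R x + s *\<^sub>R y) + (f x)\<^sup>2 \<partial>std_gaussian)"
      by (simp add: power2_diff algebra_simps)
    also have "\<dots> = T x - (2 * f x) * ornstein_uhlenbeck r f x + (f x)\<^sup>2"
      using i1 i2 by (simp add: T_def ornstein_uhlenbeck_def s_eq)
    finally show ?thesis by simp
  qed
  then have "(\<integral>x. \<integral>y. (f (r *\<^sub>R x + s *\<^sub>R y) - f x)\<^sup>2 \<partial>std_gaussian \<partial>std_gaussian)
      = (\<integral>x. T x - 2 * (f x * ornstein_uhlenbeck r f x) + (f x)\<^sup>2 \<partial>std_gaussian)"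
    by simp
  also have "\<dots> = (\<integral>x. T x \<partial>std_gaussian) - 2 * (\<integral>x. f x * ornstein_uhlenbeck r f x \<partial>std_gaussian) + (\<integral>x. (f x)\<^sup>2 \<partial>std_gaussian)"
  proof -
    have "integrable std_gaussian T"
      by (rule gaussian.integrable_const_bound[of _ "B * B"]) (auto simp: TB)
    moreover have "integrable std_gaussian (\<lambda>x. f x * ornstein_uhlenbeck r f x)"
      by (rule gaussian.integrable_const_bound[of _ "B * B"]) (auto simp: abs_mult B0 intro!: mult_mono B ouB)
    moreover have "integrable std_gaussian (\<lambda>x. (f x)\<^sup>2)"
      by (rule gaussian.integrable_const_bound[of _ "B * B"]) (auto simp: sqB)
    ultimately show ?thesis
      by simp
  qed
  also have "(\<integral>x. T x \<partial>std_gaussian) = (\<integral>x. (f x)\<^sup>2 \<partial>std_gaussian)"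
    unfolding T_def
    using integral_std_gaussian_combination[OF s(2) _ _ , of "\<lambda>x. (f x)\<^sup>2" "B * B"] s sqB by simp
  finally show ?thesis
    using ornstein_uhlenbeck_spectral_gap[OF r f B lip mean]
    unfolding r_def[symmetric] s_def[symmetric] by (simp add: algebra_simps)
qed

lemma integrable_std_gaussian_pair_norm:
  "integrable (std_gaussian \<Otimes>\<^sub>M std_gaussian) (\<lambda>z::'a::euclidean_space \<times> 'a. (norm (fst z))\<^sup>2 + (norm (snd z))\<^sup>2)"
proof (rule gaussian_pair.Fubini_integrable)
  show "integrable std_gaussian (\<lambda>x::'a. \<integral>y. norm ((norm (fst (x, y)))\<^sup>2 + (norm (snd (x, y :: 'a)))\<^sup>2) \<partial>std_gaussian)"
    by (simp add: integrable_std_gaussian_norm)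
qed (auto simp: integrable_std_gaussian_norm)

text \<open>The rotation inequality is divided by \<theta>^2. On the left 2 (1 - cos \<theta>) /
  \<theta>^2 tends to 1; on the right the difference quotient tends to the inner product of D x and
  y, whose second moment in the Gaussian variable y is the squared norm of D x.\<close>

lemma std_gaussian_poincare_centered:
  fixes f :: "real^'n \<Rightarrow> real"
  assumes f[measurable]: "f \<in> borel_measurable borel" and B: "\<And>x. \<bar>f x\<bar> \<le> B"
    and lip: "\<And>x y. \<bar>f x - f y\<bar> \<le> L * norm (x - y)"
    and D[measurable]: "D \<in> borel_measurable borel"
    and deriv: "\<And>x. (f has_derivative (\<lambda>h. D x \<bullet> h)) (at x)"
    and mean: "(\<integral>x. f x \<partial>std_gaussian) = 0"
  shows "(\<integral>x. (f x)\<^sup>2 \<partial>std_gaussian) \<le> (\<integral>x. (norm (D x))\<^sup>2 \<partial>std_gaussian)"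
proof -
  let ?G = "std_gaussian \<Otimes>\<^sub>M std_gaussian :: ((real^'n) \<times> (real^'n)) measure"
  define \<theta> :: "nat \<Rightarrow> real" where "\<theta> n = inverse (real (Suc n))" for n
  have \<theta>0: "0 < \<theta> n" and \<theta>1: "\<theta> n \<le> 1" for n
    by (auto simp: \<theta>_def field_simps)
  have \<theta>pi: "\<theta> n < pi / 2" for n
    using \<theta>1[of n] pi_gt3 by simp
  have \<theta>lim: "\<theta> \<longlonglongrightarrow> 0"
    unfolding \<theta>_def by (rule LIMSEQ_inverse_real_of_nat)
  have \<theta>at: "filterlim \<theta> (at 0) sequentially"
    using \<theta>lim \<theta>0 by (auto simp: filterlim_at less_imp_neq[symmetric])
  have "0 \<le> L"
  proof -
    obtain b :: "real^'n" where "b \<in> Basis" using nonempty_Basis by blast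
    then show ?thesis
      using lip[of b 0] by simp
  qed
  define Q where "Q n z = ((f (cos (\<theta> n) *\<^sub>R fst z + sin (\<theta> n) *\<^sub>R snd z) - f (fst z)) / \<theta> n)\<^sup>2" for n z
  define W where "W z = (D (fst z) \<bullet> snd z)\<^sup>2" for z
  let ?w = "\<lambda>z::(real^'n) \<times> (real^'n). 2 * L\<^sup>2 * ((norm (fst z))\<^sup>2 + (norm (snd z))\<^sup>2)"
  have Qm[measurable]: "Q n \<in> borel_measurable ?G" for n
    unfolding Q_def by measurable
  have Wm[measurable]: "W \<in> borel_measurable ?G"
    unfolding W_def by measurable
  have w: "integrable ?G ?w"
    by (intro integrable_mult_right integrable_std_gaussian_pair_norm)
  have lim: "(\<lambda>n. Q n z) \<longlonglongrightarrow> W z" for z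
  proof -
    obtain x y where z: "z = (x, y)" by (cases z)
    have c: "((\<lambda>t. cos t *\<^sub>R x + sin t *\<^sub>R y) has_derivative (\<lambda>h. h *\<^sub>R y)) (at 0)"
      by (auto intro!: derivative_eq_intros)
    have "(f has_derivative (\<lambda>h. D x \<bullet> h)) (at (cos 0 *\<^sub>R x + sin 0 *\<^sub>R y))"
      using deriv by simp
    from diff_chain_at[OF c this]
    have "((\<lambda>t. f (cos t *\<^sub>R x + sin t *\<^sub>R y)) has_derivative (\<lambda>h. D x \<bullet> (h *\<^sub>R y))) (at 0)"
      by (simp add: o_def)
    then have "((\<lambda>t. f (cos t *\<^sub>R x + sin t *\<^sub>R y)) has_field_derivative (D x \<bullet> y)) (at 0)"
      unfolding has_field_derivative_def by (simp add: mult.commute[of _ "D x \<bullet> y"] fun_eq_iff)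
    then have "((\<lambda>t. (f (cos t *\<^sub>R x + sin t *\<^sub>R y) - f x) / t) \<longlongrightarrow> D x \<bullet> y) (at 0)"
      unfolding has_field_derivative_iff by simp
    from filterlim_compose[OF this \<theta>at] show ?thesis
      unfolding Q_def W_def z by (auto intro!: tendsto_power)
  qed
  have bound: "norm (Q n z) \<le> ?w z" for n z
  proof -
    obtain x y where z: "z = (x, y)" by (cases z)
    let ?v = "cos (\<theta> n) *\<^sub>R x + sin (\<theta> n) *\<^sub>R y"
    \<comment> \<open>The left side is at most \<theta>^2 / 2, and \<theta> \<le> 1 weakens this to
      a linear bound. The difference quotient is then at most L (|x| + |y|), uniformly in n.\<close>
    have "1 - cos (\<theta> n) \<le> \<theta> n"
    proof -
      have "1 - cos (\<theta> n) = 2 * (sin (\<theta> n / 2))\<^sup>2"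
        using cos_double_sin[of "\<theta> n / 2"] by simp
      also have "\<dots> \<le> 2 * (\<theta> n / 2)\<^sup>2"
        using abs_sin_x_le_abs_x[of "\<theta> n / 2"] by (simp only: abs_le_square_iff mult_left_mono zero_le_numeral)
      also have "\<dots> \<le> \<theta> n"
        using \<theta>0[of n] \<theta>1[of n] by (simp add: power2_eq_square field_simps mult_left_le)
      finally show ?thesis .
    qed
    then have "\<bar>cos (\<theta> n) - 1\<bar> \<le> \<theta> n"
      using cos_le_one[of "\<theta> n"] by simp
    moreover have "\<bar>sin (\<theta> n)\<bar> \<le> \<theta> n"
      using abs_sin_x_le_abs_x[of "\<theta> n"] \<theta>0[of n] by simp
    moreover have "?v - x = (cos (\<theta> n) - 1) *\<^sub>R x + sin (\<theta> n) *\<^sub>R y"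
      by (simp add: algebra_simps)
    ultimately have "norm (?v - x) \<le> \<theta> n * norm x + \<theta> n * norm y"
      by (metis (no_types, lifting) add_mono mult_right_mono norm_ge_zero norm_scaleR norm_triangle_le)
    then have "L * norm (?v - x) \<le> L * (\<theta> n * norm x + \<theta> n * norm y)"
      using \<open>0 \<le> L\<close> by (rule mult_left_mono)
    then have "\<bar>f ?v - f x\<bar> \<le> \<theta> n * (L * (norm x + norm y))"
      using lip[of ?v x] by (simp add: algebra_simps)
    then have "\<bar>(f ?v - f x) / \<theta> n\<bar> \<le> L * (norm x + norm y)"
      using \<theta>0[of n] by (simp add: abs_div field_simps)
    then have "((f ?v - f x) / \<theta> n)\<^sup>2 \<le> (L * (norm x + norm y))\<^sup>2"
      using power_mono[OF _ abs_ge_zero, of "(f ?v - f x) / \<theta> n" "L * (norm x + norm y)" 2] by (simp only: power2_abs)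
    also have "\<dots> \<le> L\<^sup>2 * (2 * ((norm x)\<^sup>2 + (norm y)\<^sup>2))"
      unfolding power_mult_distrib
      using sum_squares_bound[of "norm x" "norm y"] by (intro mult_left_mono) (auto simp: power2_sum)
    finally show ?thesis
      by (simp add: Q_def z algebra_simps)
  qed
  note dom = integrable_dominated_convergence[OF Wm Qm w AE_I2 AE_I2, OF lim bound]
    integral_dominated_convergence[OF Wm Qm w AE_I2 AE_I2, OF lim bound]
  have Qi: "integrable ?G (Q n)" for n
    using w Qm by (rule Bochner_Integration.integrable_bound) (use bound in \<open>auto intro!: AE_I2 intro: order_trans[OF _ abs_ge_self]\<close>)
  have "2 * ((1 - cos (\<theta> n)) / (\<theta> n)\<^sup>2) * (\<integral>x. (f x)\<^sup>2 \<partial>std_gaussian) \<le> (\<integral>z. Q n z \<partial>?G)" for n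
  proof -
    have "2 * (1 - cos (\<theta> n)) * (\<integral>x. (f x)\<^sup>2 \<partial>std_gaussian) / (\<theta> n)\<^sup>2
      \<le> (\<integral>x. \<integral>y. (f (cos (\<theta> n) *\<^sub>R x + sin (\<theta> n) *\<^sub>R y) - f x)\<^sup>2 \<partial>std_gaussian \<partial>std_gaussian) / (\<theta> n)\<^sup>2"
      by (intro divide_right_mono std_gaussian_variance_le_rotation[OF \<theta>0 \<theta>pi f B lip mean]) simp
    also have "\<dots> = (\<integral>z. Q n z \<partial>?G)"
      unfolding gaussian_pair.integral_fst'[OF Qi, symmetric] by (simp add: Q_def power_divide)
    finally show ?thesis
      by (simp add: field_simps)
  qed
  moreover have "(\<lambda>n. 2 * ((1 - cos (\<theta> n)) / (\<theta> n)\<^sup>2) * (\<integral>x. (f x)\<^sup>2 \<partial>std_gaussian)) \<longlonglongrightarrow> 2 * (1 / 2) * (\<integral>x. (f x)\<^sup>2 \<partial>std_gaussian)"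
  proof -
    \<comment> \<open>This limit 1/2 cancels the factor 2, so the inequality comes out with the
      sharp constant 1.\<close>
    have "((\<lambda>t::real. (1 - cos t) / t\<^sup>2) \<longlongrightarrow> 1 / 2) (at 0)"
      by real_asymp
    from filterlim_compose[OF this \<theta>at] show ?thesis
      by (rule tendsto_mult_right[OF tendsto_mult_left])
  qed
  ultimately have "2 * (1 / 2) * (\<integral>x. (f x)\<^sup>2 \<partial>std_gaussian) \<le> (\<integral>z. W z \<partial>?G)"
    using dom(2) by (intro LIMSEQ_le[OF _ dom(2)]) auto
  also have "(\<integral>z. W z \<partial>?G) = (\<integral>x. (norm (D x))\<^sup>2 \<partial>std_gaussian)"
    unfolding gaussian_pair.integral_fst'[OF dom(1), symmetric] by (simp add: W_def std_gaussian_second_moment)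
  finally show ?thesis by simp
qed

theorem std_gaussian_poincare:
  fixes f :: "real^'n \<Rightarrow> real"
  assumes f[measurable]: "f \<in> borel_measurable borel" and B: "\<And>x. \<bar>f x\<bar> \<le> B"
    and lip: "\<And>x y. \<bar>f x - f y\<bar> \<le> L * norm (x - y)"
    and D: "D \<in> borel_measurable borel"
    and deriv: "\<And>x. (f has_derivative (\<lambda>h. D x \<bullet> h)) (at x)"
  shows "(\<integral>x. (f x)\<^sup>2 \<partial>std_gaussian) - (\<integral>x. f x \<partial>std_gaussian)\<^sup>2 \<le> (\<integral>x. (norm (D x))\<^sup>2 \<partial>std_gaussian)"
proof -
  define m where "m = (\<integral>x. f x \<partial>std_gaussian)"
  have i: "integrable std_gaussian f"
    by (rule gaussian.integrable_const_bound[of _ B]) (auto simp: B)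
  have "(f x)\<^sup>2 \<le> B\<^sup>2" for x
    using power_mono[OF B[of x] abs_ge_zero, of 2] by simp
  then have i2: "integrable std_gaussian (\<lambda>x. (f x)\<^sup>2)"
    by (intro gaussian.integrable_const_bound[of _ "B\<^sup>2"]) auto
  have mB: "\<bar>m\<bar> \<le> B"
    unfolding m_def by (rule gaussian.abs_integral_le_const) (auto simp: B)
  have "(\<integral>x. (f x - m)\<^sup>2 \<partial>std_gaussian) \<le> (\<integral>x. (norm (D x))\<^sup>2 \<partial>std_gaussian)"
  proof (rule std_gaussian_poincare_centered[where B = "B + B" and L = L])
    show "\<bar>f x - m\<bar> \<le> B + B" for x
      using B[of x] mB by linarith
    show "((\<lambda>x. f x - m) has_derivative (\<lambda>h. D x \<bullet> h)) (at x)" for x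
      using has_derivative_diff[OF deriv[of x] has_derivative_const[of m]] by simp
    show "(\<integral>x. f x - m \<partial>std_gaussian) = 0"
      using i by (simp add: m_def)
  qed (use lip D in auto)
  moreover have "(\<lambda>x. (f x - m)\<^sup>2) = (\<lambda>x. (f x)\<^sup>2 - (2 * m) * f x + m\<^sup>2)"
    by (auto simp: power2_eq_square algebra_simps)
  ultimately show ?thesis
    using i i2 by (simp add: m_def[symmetric] power2_eq_square)
qed

section \<open>Projections onto cones and faces of polyhedral cones\<close>

text \<open>Testing the variational inequality of the projection p with 0 and with p + p gives
  orthogonality, which in turn reduces the inequality to the polar condition.\<close>

lemma closest_point_cone:
  fixes C :: "'a::euclidean_space set"
  assumes C: "closed C" "convex_cone C"
  shows closest_point_cone_in: "closest_point C x \<in> C"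
    and closest_point_cone_orthogonal: "(x - closest_point C x) \<bullet> closest_point C x = 0"
    and closest_point_cone_polar: "y \<in> C \<Longrightarrow> (x - closest_point C x) \<bullet> y \<le> 0"
proof -
  let ?p = "closest_point C x"
  have cvx: "convex C" and ne: "C \<noteq> {}"
    using C(2) by (auto simp: convex_cone_def)
  show p: "?p \<in> C"
    by (rule closest_point_in_set[OF C(1) ne])
  have dot: "(x - ?p) \<bullet> (y - ?p) \<le> 0" if "y \<in> C" for y
    by (rule closest_point_dot[OF cvx C(1) that])
  have "(x - ?p) \<bullet> ?p \<ge> 0"
    using dot[OF convex_cone_contains_0[OF C(2)]] by simp
  moreover have "(x - ?p) \<bullet> ?p \<le> 0"
    using dot[OF convex_cone_add[OF C(2) p p]] by simp
  ultimately show orth: "(x - ?p) \<bullet> ?p = 0" by simp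
  show "(x - ?p) \<bullet> y \<le> 0" if "y \<in> C"
    using dot[OF that] orth by (simp add: inner_diff_right)
qed

text \<open>These conditions characterise the projection: for z in the cone, the squared distance to
  z exceeds that to p by at least |p - z|^2. Projections can thus be found by guessing p and
  checking it.\<close>

lemma closest_point_coneI:
  fixes C :: "'a::euclidean_space set"
  assumes C: "closed C" "convex_cone C"
    and p: "p \<in> C" "(x - p) \<bullet> p = 0" "\<And>y. y \<in> C \<Longrightarrow> (x - p) \<bullet> y \<le> 0"
  shows "closest_point C x = p"
proof -
  have "dist x p \<le> dist x z" if "z \<in> C" for z
  proof -
    have "0 \<le> (x - p) \<bullet> (p - z)"
      using p(3)[OF that] p(2) by (simp add: inner_diff_right)
    then have "(norm (x - p))\<^sup>2 \<le> (norm ((x - p) + (p - z)))\<^sup>2"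
      unfolding power2_norm_eq_inner[of "(x - p) + (p - z)"] inner_add_left inner_add_right
      by (simp add: power2_norm_eq_inner inner_commute)
    then show ?thesis
      by (simp add: dist_norm)
  qed
  then show ?thesis
    using closest_point_unique[of C p x] C p(1) by (auto simp: convex_cone_def)
qed

lemma closed_polar_cone: "closed (polar_cone C)"
proof -
  have "polar_cone C = (\<Inter>x\<in>C. {u. x \<bullet> u \<le> 0})"
    by (auto simp: polar_cone_def inner_commute)
  then show ?thesis
    by (simp add: closed_INT closed_halfspace_le)
qed

lemma convex_cone_polar_cone: "convex_cone (polar_cone C)"
  by (auto simp: convex_cone_iff polar_cone_def inner_add_left add_nonpos_nonpos mult_nonneg_nonpos)

text \<open>Moreau's decomposition: the characterising conditions are symmetric in the projection
  and the residual.\<close>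

lemma closest_point_polar_cone:
  fixes C :: "'a::euclidean_space set"
  assumes C: "closed C" "convex_cone C"
  shows "closest_point (polar_cone C) x = x - closest_point C x"
proof (rule closest_point_coneI[OF closed_polar_cone convex_cone_polar_cone])
  show "x - closest_point C x \<in> polar_cone C"
    using closest_point_cone_polar[OF C] by (simp add: polar_cone_def)
  show "(x - (x - closest_point C x)) \<bullet> (x - closest_point C x) = 0"
    using closest_point_cone_orthogonal[OF C, of x] by (simp add: inner_commute)
  fix y assume "y \<in> polar_cone C"
  then have "y \<bullet> closest_point C x \<le> 0"
    using closest_point_cone_in[OF C, of x] by (simp add: polar_cone_def)
  then show "(x - (x - closest_point C x)) \<bullet> y \<le> 0"
    by (simp add: inner_commute)
qed

lemma inner_closest_point_cone:
  fixes C :: "'a::euclidean_space set"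
  assumes C: "closed C" "convex_cone C"
  shows "x \<bullet> closest_point C x = (norm (closest_point C x))\<^sup>2"
  using closest_point_cone_orthogonal[OF C, of x] by (simp add: inner_diff_left power2_norm_eq_inner)

lemma norm_closest_point_cone_pythagoras:
  fixes C :: "'a::euclidean_space set"
  assumes C: "closed C" "convex_cone C"
  shows "(norm x)\<^sup>2 = (norm (closest_point C x))\<^sup>2 + (norm (x - closest_point C x))\<^sup>2"
  using inner_closest_point_cone[OF C, of x]
  by (simp add: power2_norm_eq_inner inner_diff inner_commute)

lemma dist_closest_point_cone_le:
  fixes C :: "'a::euclidean_space set"
  assumes C: "closed C" "convex_cone C"
  shows "norm (closest_point C x - closest_point C y) \<le> norm (x - y)"
  using closest_point_lipschitz[of C x y] C by (auto simp: convex_cone_def dist_norm)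

lemma closest_point_cone_zero:
  assumes C: "closed C" "convex_cone C"
  shows "closest_point C 0 = 0"
  using convex_cone_contains_0[OF C(2)] by (rule closest_point_self)

lemma norm_closest_point_cone_le:
  fixes C :: "'a::euclidean_space set"
  assumes C: "closed C" "convex_cone C"
  shows "norm (closest_point C x) \<le> norm x"
  using dist_closest_point_cone_le[OF C, of x 0] by (simp add: closest_point_cone_zero[OF C])

lemma borel_measurable_closest_point [measurable]:
  fixes C :: "'a::euclidean_space set"
  assumes C: "closed C" "convex_cone C"
  shows "closest_point C \<in> borel_measurable borel"
  using C by (intro borel_measurable_continuous_onI continuous_on_closest_point) (auto simp: convex_cone_def)

text \<open>The squared norm of the projection is |x|^2 minus the squared distance to the cone.
  Bounding the distance of y by its distance to the projection of x shows that twice this projection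
  is a subgradient at x.\<close>

lemma norm_closest_point_cone_subgradient:
  fixes C :: "'a::euclidean_space set"
  assumes C: "closed C" "convex_cone C"
  shows "(norm (closest_point C x))\<^sup>2 + 2 * ((y - x) \<bullet> closest_point C x) \<le> (norm (closest_point C y))\<^sup>2"
proof -
  have "norm (y - closest_point C y) \<le> norm (y - closest_point C x)"
    using closest_point_le[OF C(1) closest_point_cone_in[OF C]] by (simp add: dist_norm)
  then have "(norm (y - closest_point C y))\<^sup>2 \<le> (norm (y - closest_point C x))\<^sup>2"
    by (intro power_mono) auto
  also have "\<dots> = (norm y)\<^sup>2 - 2 * (y \<bullet> closest_point C x) + (norm (closest_point C x))\<^sup>2"
    by (simp add: power2_norm_eq_inner inner_diff inner_commute)
  finally show ?thesis
    using norm_closest_point_cone_pythagoras[OF C, of y] inner_closest_point_cone[OF C, of x]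
    by (simp add: inner_diff_left)
qed

text \<open>The subgradient inequalities at x and at y place the remainder between 0 and 2 |y -
  x|^2, the projection being 1-Lipschitz. So the squared norm is differentiable everywhere, even
  where the projection is not.\<close>

lemma has_derivative_norm_closest_point_cone:
  fixes C :: "'a::euclidean_space set"
  assumes C: "closed C" "convex_cone C"
  shows "((\<lambda>x. (norm (closest_point C x))\<^sup>2) has_derivative (\<lambda>h. 2 * (closest_point C x \<bullet> h))) (at x)"
  unfolding has_derivative_at_alt
proof (intro conjI allI impI)
  show "bounded_linear (\<lambda>h. 2 * (closest_point C x \<bullet> h))"
    by (intro bounded_linear_const_mult bounded_linear_inner_right)
  fix e :: real assume "0 < e"
  show "\<exists>d>0. \<forall>y. norm (y - x) < d \<longrightarrow>
    norm ((norm (closest_point C y))\<^sup>2 - (norm (closest_point C x))\<^sup>2 - 2 * (closest_point C x \<bullet> (y - x))) \<le> e * norm (y - x)"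
  proof (intro exI[of _ "e / 2"] conjI allI impI)
    fix y assume y: "norm (y - x) < e / 2"
    let ?d = "(norm (closest_point C y))\<^sup>2 - (norm (closest_point C x))\<^sup>2 - 2 * (closest_point C x \<bullet> (y - x))"
    have "0 \<le> ?d"
      using norm_closest_point_cone_subgradient[OF C, of x y] by (simp add: inner_commute)
    moreover have "?d \<le> 2 * ((y - x) \<bullet> (closest_point C y - closest_point C x))"
      using norm_closest_point_cone_subgradient[OF C, of y x]
      by (simp add: inner_diff inner_commute)
    moreover have "(y - x) \<bullet> (closest_point C y - closest_point C x) \<le> norm (y - x) * norm (y - x)"
      using dist_closest_point_cone_le[OF C, of y x]
      by (intro order_trans[OF norm_cauchy_schwarz]) (simp add: mult_left_mono)
    moreover have "norm (y - x) * norm (y - x) \<le> (e / 2) * norm (y - x)"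
      using y by (intro mult_right_mono) auto
    ultimately show "norm ?d \<le> e * norm (y - x)"
      by simp
  qed (use \<open>0 < e\<close> in simp)
qed

section \<open>Faces of polyhedral cones\<close>

text \<open>For u in the polar cone the supremum is 0, attained at the origin.\<close>

lemma cone_face_iff:
  fixes C :: "'a::euclidean_space set"
  assumes C: "convex_cone C"
  shows "cone_face C F \<longleftrightarrow> (\<exists>u\<in>polar_cone C. F = {x \<in> C. u \<bullet> x = 0})"
proof -
  have "(SUP y\<in>C. u \<bullet> y) = 0" if "u \<in> polar_cone C" for u
  proof (rule cSup_eq_maximum)
    show "0 \<in> (\<lambda>y. u \<bullet> y) ` C"
      using convex_cone_contains_0[OF C] by force
    show "\<And>x. x \<in> (\<lambda>y. u \<bullet> y) ` C \<Longrightarrow> x \<le> 0"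
      using that by (auto simp: polar_cone_def)
  qed
  then show ?thesis
    unfolding cone_face_def by (auto cong: bex_cong)
qed

lemma cone_face_imp:
  fixes C :: "'a::euclidean_space set"
  assumes C: "convex_cone C" and F: "cone_face C F"
  shows cone_face_subset: "F \<subseteq> C" and convex_cone_cone_face: "convex_cone F" and cone_face_face_of: "F face_of C"
proof -
  obtain u where u: "\<And>x. x \<in> C \<Longrightarrow> u \<bullet> x \<le> 0" "F = C \<inter> {x. u \<bullet> x = 0}"
    using F unfolding cone_face_iff[OF C] by (auto simp: polar_cone_def)
  show "F \<subseteq> C" using u by auto
  show "convex_cone F"
    using C unfolding u(2) convex_cone_iff by (auto simp: inner_add_right)
  show "F face_of C"
    unfolding u(2) using C u(1) by (intro face_of_Int_supporting_hyperplane_le) (auto simp: convex_cone_def)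
qed

lemma closed_convex_cone_polyhedral_cone:
  assumes "polyhedral_cone C"
  shows closed_polyhedral_cone: "closed C" and convex_cone_polyhedral_cone: "convex_cone C"
  using assms unfolding polyhedral_cone_def
  by (auto simp: closed_INT closed_halfspace_ge intro!: convex_cone_Inter convex_cone_halfspace_ge)

lemma finite_cone_faces:
  assumes "polyhedral_cone C"
  shows "finite {F. cone_face C F}"
proof -
  obtain U where U: "finite U" "C = (\<Inter>u\<in>U. {x. 0 \<le> u \<bullet> x})"
    using assms by (auto simp: polyhedral_cone_def)
  have "polyhedron C"
    unfolding U(2) using U(1) by (intro polyhedron_Inter) (auto simp: polyhedron_halfspace_ge)
  then have "finite {F. F face_of C}"
    by (rule finite_polyhedron_faces)
  then show ?thesis
    by (rule rev_finite_subset)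
       (auto intro: cone_face_face_of convex_cone_polyhedral_cone assms)
qed

text \<open>The face cut out by the sum of the constraints active at \<open>a\<close>.\<close>

lemma exists_cone_face_rel_interior:
  fixes C :: "'a::euclidean_space set"
  assumes P: "polyhedral_cone C" and a: "a \<in> C"
  shows "\<exists>F. cone_face C F \<and> a \<in> rel_interior F"
proof -
  obtain U where U: "finite U" "C = (\<Inter>u\<in>U. {x. 0 \<le> u \<bullet> x})"
    using P by (auto simp: polyhedral_cone_def)
  define A where "A = {u\<in>U. u \<bullet> a = 0}"
  \<comment> \<open>The minus sign turns constraints of the form
    \<open>0 \<le> u \<bullet> x\<close> into an element of the polar cone.\<close>
  define w where "w = - (\<Sum>u\<in>A. u)"
  define F where "F = {x \<in> C. w \<bullet> x = 0}"
  have finA: "finite A" and AU: "A \<subseteq> U"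
    using U(1) by (auto simp: A_def)
  have w: "w \<bullet> x = - (\<Sum>u\<in>A. u \<bullet> x)" for x
    by (simp add: w_def inner_sum_left)
  have nn: "0 \<le> u \<bullet> x" if "u \<in> U" "x \<in> C" for u x
    using that by (auto simp: U(2))
  have "w \<in> polar_cone C"
    using nn AU by (auto simp: polar_cone_def w intro!: sum_nonneg)
  then have face: "cone_face C F"
    unfolding cone_face_iff[OF convex_cone_polyhedral_cone[OF P]] F_def by blast
  have "w \<bullet> x = 0 \<longleftrightarrow> (\<forall>u\<in>A. u \<bullet> x = 0)" if "x \<in> C" for x
  proof -
    have "\<And>u. u \<in> A \<Longrightarrow> 0 \<le> u \<bullet> x"
      using nn AU that by blast
    from sum_nonneg_eq_0_iff[OF finA this] show ?thesis
      by (simp add: w)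
  qed
  then have F_eq: "F = {x \<in> C. \<forall>u\<in>A. u \<bullet> x = 0}"
    unfolding F_def by (intro Collect_cong conj_cong refl)
  have sub: "affine hull F \<subseteq> {x. \<forall>u\<in>A. u \<bullet> x = 0}"
  proof (rule hull_minimal)
    show "F \<subseteq> {x. \<forall>u\<in>A. u \<bullet> x = 0}" by (auto simp: F_eq)
    show "affine {x. \<forall>u\<in>A. u \<bullet> x = 0}"
      by (auto simp: affine_def inner_add_right)
  qed
  \<comment> \<open>On this open set the inactive constraints stay strict, and on the affine hull of
    \<open>F\<close> the active ones vanish; together they put a point into
    \<open>F\<close>.\<close>
  let ?T = "\<Inter>u\<in>U - A. {x. 0 < u \<bullet> x}"
  have "a \<in> rel_interior F"
    unfolding mem_rel_interior
  proof (intro exI[of _ ?T] conjI)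
    show "open ?T"
      using U(1) by (intro open_INT) (auto simp: open_halfspace_gt)
    have "a \<in> F" using a by (auto simp: F_eq A_def)
    moreover have "a \<in> ?T"
      using nn[OF _ a] by (auto simp: A_def order_less_le)
    ultimately show "a \<in> ?T \<inter> F" by blast
    show "?T \<inter> affine hull F \<subseteq> F"
    proof
      fix x assume x: "x \<in> ?T \<inter> affine hull F"
      then have A0: "\<forall>u\<in>A. u \<bullet> x = 0"
        using sub by blast
      have "0 \<le> u \<bullet> x" if "u \<in> U" for u
        using x A0 that by (cases "u \<in> A") (auto intro: less_imp_le)
      then show "x \<in> F"
        using A0 by (auto simp: F_eq U(2))
    qed
  qed
  then show ?thesis using face by blast
qed

lemma cone_face_rel_interior_unique:
  fixes C :: "'a::euclidean_space set"
  assumes C: "convex_cone C" and "cone_face C F" "cone_face C G" "a \<in> rel_interior F" "a \<in> rel_interior G"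
  shows "F = G"
  using face_of_eq[OF cone_face_face_of[OF C assms(2)] cone_face_face_of[OF C assms(3)]] assms(4,5) by blast

text \<open>Since the projection p is relatively interior, the segment from y in F to p extends a
  little beyond p inside F. The residual is orthogonal to p, so the polar inequality at the extended
  point is the reversed inequality at y.\<close>

lemma span_orthogonal_closest_point_cone_face:
  fixes C :: "'a::euclidean_space set"
  assumes C: "closed C" "convex_cone C" and F: "cone_face C F"
    and p: "closest_point C g \<in> rel_interior F" and x: "x \<in> span F"
  shows "(g - closest_point C g) \<bullet> x = 0"
proof -
  have "(g - closest_point C g) \<bullet> y = 0" if y: "y \<in> F" for y
  proof -
    have "convex F"
      using convex_cone_cone_face[OF C(2) F] by (simp add: convex_cone_def)
    then obtain e where e: "e > 1" "(1 - e) *\<^sub>R y + e *\<^sub>R closest_point C g \<in> F"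
      using convex_rel_interior_if2[OF _ p] hull_inc[OF y] by blast
    have "(g - closest_point C g) \<bullet> ((1 - e) *\<^sub>R y + e *\<^sub>R closest_point C g) \<le> 0"
      using e(2) cone_face_subset[OF C(2) F] by (intro closest_point_cone_polar[OF C]) auto
    then have "(1 - e) * ((g - closest_point C g) \<bullet> y) \<le> 0"
      by (simp add: inner_add_right closest_point_cone_orthogonal[OF C])
    then have "0 \<le> (g - closest_point C g) \<bullet> y"
      using e(1) by (simp add: mult_le_0_iff)
    moreover have "(g - closest_point C g) \<bullet> y \<le> 0"
      using y cone_face_subset[OF C(2) F] by (intro closest_point_cone_polar[OF C]) auto
    ultimately show ?thesis by simp
  qed
  then have "span F \<subseteq> {x. (g - closest_point C g) \<bullet> x = 0}"
    by (intro span_minimal) (auto simp: subspace_hyperplane)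
  then show ?thesis
    using x by blast
qed

lemma rel_interior_cone_scaleR:
  fixes F :: "'a::euclidean_space set"
  assumes F: "convex_cone F" and c: "0 < c" and x: "x \<in> rel_interior F"
  shows "c *\<^sub>R x \<in> rel_interior F"
proof -
  have "(*\<^sub>R) c ` F = F"
  proof
    show "(*\<^sub>R) c ` F \<subseteq> F"
      using convex_cone_scaleR[OF F] c by auto
    show "F \<subseteq> (*\<^sub>R) c ` F"
    proof
      fix y assume "y \<in> F"
      then have "inverse c *\<^sub>R y \<in> F"
        using convex_cone_scaleR[OF F] c by simp
      moreover have "y = c *\<^sub>R (inverse c *\<^sub>R y)"
        using c by simp
      ultimately show "y \<in> (*\<^sub>R) c ` F" by blast
    qed
  qed
  moreover have "convex F"
    using F by (simp add: convex_cone_def)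
  ultimately show ?thesis
    using rel_interior_convex_scaleR[of F c] x by auto
qed

lemma borel_rel_interior [measurable]:
  fixes F :: "'a::euclidean_space set"
  shows "rel_interior F \<in> sets borel"
proof -
  obtain T where "open T" "rel_interior F = affine hull F \<inter> T"
    using openin_rel_interior[of F] by (auto simp: openin_open)
  then show ?thesis
    using sets.Int[OF borel_closed[OF closed_affine_hull] borel_open] by simp
qed

text \<open>This carries the splitting into \<open>L\<close> and its orthogonal complement over to a
  splitting of the coordinates, so that scaling the two parts separately becomes a diagonal map with
  a known determinant. \<open>V\<close> sends the standard basis to orthonormal bases of both
  parts.\<close>

lemma orthogonal_transformation_adapted:
  fixes L :: "'a::euclidean_space set"
  assumes L: "subspace L"
  obtains V :: "'a \<Rightarrow> 'a" and S :: "'a set" where "orthogonal_transformation V" "S \<subseteq> Basis" "card S = dim L"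
    "\<And>b. b \<in> S \<Longrightarrow> V b \<in> L" "\<And>b x. b \<in> Basis - S \<Longrightarrow> x \<in> L \<Longrightarrow> V b \<bullet> x = 0"
proof -
  define M where "M = {y. \<forall>x\<in>L. orthogonal x y}"
  have M: "subspace M"
    unfolding M_def by (rule subspace_orthogonal_to_vectors)
  have dims: "dim M + dim L = DIM('a)"
    using dim_subspace_orthogonal_to_vectors[OF L subspace_UNIV] by (simp add: M_def)
  obtain B1 where B1: "B1 \<subseteq> L" "pairwise orthogonal B1" "\<And>x. x \<in> B1 \<Longrightarrow> norm x = 1" "independent B1" "card B1 = dim L"
    using orthonormal_basis_subspace[OF L] by metis
  obtain B2 where B2: "B2 \<subseteq> M" "pairwise orthogonal B2" "\<And>x. x \<in> B2 \<Longrightarrow> norm x = 1" "independent B2" "card B2 = dim M"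
    using orthonormal_basis_subspace[OF M] by metis
  have fin: "finite B1" "finite B2"
    using B1(4) B2(4) by (auto intro: independent_imp_finite)
  have "dim L \<le> card (Basis :: 'a set)"
    using dims by simp
  then obtain S :: "'a set" where S: "S \<subseteq> Basis" "card S = dim L" "finite S"
    by (rule obtain_subset_with_card_n) blast
  obtain \<beta>1 where \<beta>1: "bij_betw \<beta>1 S B1"
    using finite_same_card_bij[OF S(3) fin(1)] S(2) B1(5) by auto
  have "card (Basis - S) = card B2"
    using S B2(5) dims by (simp add: card_Diff_subset)
  then obtain \<beta>2 where \<beta>2: "bij_betw \<beta>2 (Basis - S) B2"
    using finite_same_card_bij[of "Basis - S" B2] fin by auto
  define \<beta> where "\<beta> b = (if b \<in> S then \<beta>1 b else \<beta>2 b)" for b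
  have \<beta>L: "\<beta> b \<in> L" if "b \<in> S" for b
    using that \<beta>1 B1(1) by (auto simp: \<beta>_def bij_betw_def)
  have \<beta>M: "\<beta> b \<in> M" if "b \<in> Basis - S" for b
    using that \<beta>2 B2(1) by (auto simp: \<beta>_def bij_betw_def)
  have norm\<beta>: "\<beta> b \<bullet> \<beta> b = 1" if "b \<in> Basis" for b
  proof -
    have "norm (\<beta> b) = 1"
      using that \<beta>1 \<beta>2 B1(3) B2(3) by (auto simp: \<beta>_def bij_betw_def)
    then show ?thesis by (simp add: norm_eq_1)
  qed
  have LM: "x \<bullet> y = 0" "y \<bullet> x = 0" if "x \<in> L" "y \<in> M" for x y
    using that by (auto simp: M_def orthogonal_def inner_commute)
  have orth\<beta>: "\<beta> b \<bullet> \<beta> c = 0" if "b \<in> Basis" "c \<in> Basis" "b \<noteq> c" for b c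
  proof (cases "b \<in> S \<longleftrightarrow> c \<in> S")
    case True
    show ?thesis
    proof (cases "b \<in> S")
      case True
      then have "\<beta>1 b \<noteq> \<beta>1 c" "\<beta>1 b \<in> B1" "\<beta>1 c \<in> B1"
        using \<open>b \<in> S \<longleftrightarrow> c \<in> S\<close> \<beta>1 that by (auto simp: bij_betw_def inj_on_def)
      then show ?thesis
        using B1(2) True \<open>b \<in> S \<longleftrightarrow> c \<in> S\<close> by (simp add: \<beta>_def pairwise_def orthogonal_def)
    next
      case False
      then have "\<beta>2 b \<noteq> \<beta>2 c" "\<beta>2 b \<in> B2" "\<beta>2 c \<in> B2"
        using \<open>b \<in> S \<longleftrightarrow> c \<in> S\<close> \<beta>2 that by (auto simp: bij_betw_def inj_on_def)
      then show ?thesis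
        using B2(2) False \<open>b \<in> S \<longleftrightarrow> c \<in> S\<close> by (simp add: \<beta>_def pairwise_def orthogonal_def)
    qed
  next
    case False
    then show ?thesis
      using \<beta>L \<beta>M LM that by (cases "b \<in> S") auto
  qed
  define V where "V x = (\<Sum>b\<in>Basis. (x \<bullet> b) *\<^sub>R \<beta> b)" for x
  have Vb: "V b = \<beta> b" if "b \<in> Basis" for b
  proof -
    have "V b = (\<Sum>c\<in>Basis. if c = b then \<beta> c else 0)"
      unfolding V_def using that by (intro sum.cong refl) (auto simp: inner_Basis)
    then show ?thesis using that by simp
  qed
  have "orthogonal_transformation V"
    unfolding orthogonal_transformation_def
  proof (intro conjI allI)
    show "linear V"
      unfolding V_def by (intro linear_compose_sum ballI linearI) (auto simp: inner_add_left scaleR_add_left)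
    fix v w
    have "V v \<bullet> V w = (\<Sum>b\<in>Basis. \<Sum>c\<in>Basis. (v \<bullet> b) * (w \<bullet> c) * (\<beta> b \<bullet> \<beta> c))"
      unfolding V_def inner_sum_left by (simp add: inner_sum_right sum_distrib_left mult_ac)
    also have "\<dots> = (\<Sum>b\<in>Basis. \<Sum>c\<in>Basis. if c = b then (v \<bullet> b) * (w \<bullet> b) else 0)"
      by (intro sum.cong refl) (auto simp: norm\<beta> orth\<beta>)
    also have "\<dots> = v \<bullet> w"
      by (simp add: euclidean_inner[of v w])
    finally show "V v \<bullet> V w = v \<bullet> w" .
  qed
  moreover have "V b \<in> L" if "b \<in> S" for b
    using that S(1) Vb \<beta>L by auto
  moreover have "V b \<bullet> x = 0" if "b \<in> Basis - S" "x \<in> L" for b x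
    using that Vb \<beta>M LM by auto
  ultimately show ?thesis
    using S(1,2) by (intro that)
qed

section \<open>The Steiner formula\<close>

lemma nn_integral_lborel_diagonal:
  fixes h :: "'a::euclidean_space \<Rightarrow> ennreal"
  assumes [measurable]: "h \<in> borel_measurable borel" and c: "\<And>b. b \<in> Basis \<Longrightarrow> c b \<noteq> 0"
  shows "(\<integral>\<^sup>+x. h x \<partial>lborel) = ennreal (\<Prod>b\<in>Basis. \<bar>c b\<bar>) * (\<integral>\<^sup>+x. h (\<Sum>b\<in>Basis. (c b * (x \<bullet> b)) *\<^sub>R b) \<partial>lborel)"
proof -
  let ?T = "\<lambda>x::'a. 0 + (\<Sum>b\<in>Basis. (c b * (x \<bullet> b)) *\<^sub>R b)"
  have "(\<integral>\<^sup>+x. h x \<partial>lborel) = (\<integral>\<^sup>+x. h x \<partial>density (distr lborel borel ?T) (\<lambda>_. \<Prod>b\<in>Basis. \<bar>c b\<bar>))"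
    using lborel_affine_euclidean[where c = c and t = 0, OF c] by simp
  also have "\<dots> = ennreal (\<Prod>b\<in>Basis. \<bar>c b\<bar>) * (\<integral>\<^sup>+x. h (?T x) \<partial>lborel)"
    by (simp add: nn_integral_density nn_integral_distr nn_integral_cmult)
  finally show ?thesis by simp
qed

text \<open>The points projecting into a given relative interior stay there when the projection and
  the residual are rescaled independently.\<close>

lemma closest_point_cone_face_scale:
  fixes C :: "'a::euclidean_space set"
  assumes C: "closed C" "convex_cone C" and F: "cone_face C F"
    and p: "closest_point C g \<in> rel_interior F" and sr: "0 < s" "0 < r"
  defines "g' \<equiv> s *\<^sub>R closest_point C g + r *\<^sub>R (g - closest_point C g)"
  shows "closest_point C g' = s *\<^sub>R closest_point C g"
    and "closest_point C g' \<in> rel_interior F"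
proof -
  show eq: "closest_point C g' = s *\<^sub>R closest_point C g"
  proof (rule closest_point_coneI[OF C])
    show "s *\<^sub>R closest_point C g \<in> C"
      using sr by (intro convex_cone_scaleR[OF C(2)] closest_point_cone_in[OF C]) auto
    show "(g' - s *\<^sub>R closest_point C g) \<bullet> (s *\<^sub>R closest_point C g) = 0"
      by (simp add: g'_def closest_point_cone_orthogonal[OF C])
    show "(g' - s *\<^sub>R closest_point C g) \<bullet> y \<le> 0" if "y \<in> C" for y
      using closest_point_cone_polar[OF C that, of g] sr by (simp add: g'_def mult_nonneg_nonpos)
  qed
  show "closest_point C g' \<in> rel_interior F"
    unfolding eq by (rule rel_interior_cone_scaleR[OF convex_cone_cone_face[OF C(2) F] sr(1) p])
qed

text \<open>A change of variables in which the projection is multiplied by s and the residual by r.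
  On \<open>R\<close> the projection lies in \<open>span F\<close> and the residual is orthogonal to
  it, so the map is linear there, with the determinant on the right, and maps \<open>R\<close> onto
  itself.\<close>

lemma nn_integral_std_gaussian_face_region:
  fixes C :: "'a::euclidean_space set"
  assumes C: "closed C" "convex_cone C" and F: "cone_face C F" and sr: "0 < s" "0 < r"
  defines "R \<equiv> {g. closest_point C g \<in> rel_interior F}"
  shows "(\<integral>\<^sup>+g. ennreal (exp (- ((1 / s\<^sup>2 - 1) * (norm (closest_point C g))\<^sup>2
            + (1 / r\<^sup>2 - 1) * (norm (g - closest_point C g))\<^sup>2) / 2)) * indicator R g \<partial>std_gaussian)
    = ennreal (s ^ dim F * r ^ (DIM('a) - dim F)) * emeasure std_gaussian R"
proof -
  note [measurable] = borel_measurable_closest_point[OF C]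
  define \<pi> where "\<pi> = closest_point C"
  have [measurable]: "\<pi> \<in> borel_measurable borel"
    unfolding \<pi>_def by measurable
  have R[measurable]: "R \<in> sets borel"
    unfolding R_def by measurable
  obtain V :: "'a \<Rightarrow> 'a" and S :: "'a set"
    where V: "orthogonal_transformation V" and S': "S \<subseteq> Basis" "card S = dim (span F)"
    and VS: "\<And>b. b \<in> S \<Longrightarrow> V b \<in> span F" "\<And>b x. b \<in> Basis - S \<Longrightarrow> x \<in> span F \<Longrightarrow> V b \<bullet> x = 0"
    by (rule orthogonal_transformation_adapted[OF subspace_span[of F]]) blast
  have S: "S \<subseteq> Basis" "card S = dim F"
    using S' by (simp_all add: dim_span)
  note [measurable] = borel_measurable_orthogonal_transformation[OF V]
  have linV: "linear V" by (rule orthogonal_transformation_linear[OF V])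
  have Vdot: "V x \<bullet> V y = x \<bullet> y" for x y
    using V by (simp add: orthogonal_transformation_def)
  define D where "D s r x = (\<Sum>b\<in>Basis. ((if b \<in> S then s else r) * (x \<bullet> b)) *\<^sub>R b)" for s r :: real and x :: 'a
  have D_dot: "D s r x \<bullet> b = (if b \<in> S then s else r) * (x \<bullet> b)" if "b \<in> Basis" for s r x b
    using that by (simp add: D_def inner_sum_left inner_Basis if_distrib cong: if_cong)
  have VD: "V (D s r x) = s *\<^sub>R \<pi> (V x) + r *\<^sub>R (V x - \<pi> (V x))" if x: "V x \<in> R" for s r x
  proof -
    define p q where "p = inv V (\<pi> (V x))" and "q = x - p"
    have Vp: "V p = \<pi> (V x)"
      unfolding p_def by (rule surj_f_inv_f[OF orthogonal_transformation_surj[OF V]])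
    have Vq: "V q = V x - \<pi> (V x)"
      by (simp add: q_def linear_diff[OF linV] Vp)
    have pF: "\<pi> (V x) \<in> span F"
      using x rel_interior_subset[of F] by (auto simp: R_def \<pi>_def intro: span_base)
    have pb: "p \<bullet> b = 0" if "b \<in> Basis - S" for b
      using VS(2)[OF that pF] Vdot[of p b] by (simp add: Vp inner_commute)
    have qb: "q \<bullet> b = 0" if "b \<in> S" for b
      using span_orthogonal_closest_point_cone_face[OF C F, of "V x" "V b"] VS(1)[OF that] x Vdot[of q b]
      by (simp add: Vq R_def \<pi>_def)
    have "D s r x = s *\<^sub>R p + r *\<^sub>R q"
    proof (rule euclidean_eqI)
      fix b :: 'a assume b: "b \<in> Basis"
      have "x \<bullet> b = p \<bullet> b + q \<bullet> b"
        by (simp add: q_def inner_diff_left)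
      then show "D s r x \<bullet> b = (s *\<^sub>R p + r *\<^sub>R q) \<bullet> b"
        using pb[of b] qb[of b] b by (simp add: D_dot inner_add_left)
    qed
    then show ?thesis
      by (simp add: linear_add[OF linV] linear_scale[OF linV] Vp Vq)
  qed
  have VD_R: "V (D s r x) \<in> R" and VD_\<pi>: "\<pi> (V (D s r x)) = s *\<^sub>R \<pi> (V x)"
    if "V x \<in> R" "0 < s" "0 < r" for s r x
    using closest_point_cone_face_scale[OF C F _ that(2,3), of "V x"] that(1)
    by (auto simp: VD[OF that(1)] R_def \<pi>_def)
  have D_inv: "D (1 / s) (1 / r) (D s r x) = x" for x
    by (rule euclidean_eqI) (use sr in \<open>simp add: D_dot\<close>)
  \<comment> \<open>The converse direction applies \<open>VD_R\<close> to the inverse scaling, which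
    is why that fact is stated for arbitrary positive factors.\<close>
  have VD_iff: "V (D s r x) \<in> R \<longleftrightarrow> V x \<in> R" for x
    using VD_R[of x s r] VD_R[of "D s r x" "1 / s" "1 / r"] sr by (auto simp: D_inv)
  have prod: "(\<Prod>b\<in>Basis. \<bar>if b \<in> S then s else r\<bar>) = s ^ dim F * r ^ (DIM('a) - dim F)"
  proof -
    have "(\<Prod>b\<in>Basis. \<bar>if b \<in> S then s else r\<bar>) = (\<Prod>b\<in>S. \<bar>if b \<in> S then s else r\<bar>) * (\<Prod>b\<in>Basis - S. \<bar>if b \<in> S then s else r\<bar>)"
      using S(1) by (simp add: prod.subset_diff mult.commute)
    also have "(\<Prod>b\<in>S. \<bar>if b \<in> S then s else r\<bar>) = s ^ dim F"
      using sr S(2) by simp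
    also have "(\<Prod>b\<in>Basis - S. \<bar>if b \<in> S then s else r\<bar>) = r ^ (DIM('a) - dim F)"
      using sr S by (simp add: card_Diff_subset finite_subset[OF S(1)])
    finally show ?thesis .
  qed
  define K where "K = (1 / sqrt (2 * pi)) ^ DIM('a)"
  have K: "0 \<le> K" by (simp add: K_def)
  define h where "h g = ennreal (exp (- ((1 / s\<^sup>2 - 1) * (norm (\<pi> g))\<^sup>2 + (1 / r\<^sup>2 - 1) * (norm (g - \<pi> g))\<^sup>2) / 2)) * indicator R g" for g
  have hm[measurable]: "h \<in> borel_measurable borel"
    unfolding h_def by measurable
  \<comment> \<open>The Gaussian density times the weight: the substitution cancels s and r in the
    exponent and leaves the plain density.\<close>
  define \<Phi> where "\<Phi> g = ennreal (K * exp (- ((norm (\<pi> g))\<^sup>2 / s\<^sup>2 + (norm (g - \<pi> g))\<^sup>2 / r\<^sup>2) / 2)) * indicator R g" for g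
  have [measurable]: "\<Phi> \<in> borel_measurable borel"
    unfolding \<Phi>_def by measurable
  have Vnorm: "norm (V x) = norm x" for x
    by (rule orthogonal_transformation_norm[OF V])
  have pyth: "(norm g)\<^sup>2 = (norm (\<pi> g))\<^sup>2 + (norm (g - \<pi> g))\<^sup>2" for g
    unfolding \<pi>_def by (rule norm_closest_point_cone_pythagoras[OF C])
  have gauss: "(\<integral>\<^sup>+g. f g \<partial>std_gaussian) = (\<integral>\<^sup>+x. ennreal (K * exp (- (norm (V x))\<^sup>2 / 2)) * f (V x) \<partial>lborel)"
    if [measurable]: "f \<in> borel_measurable borel" for f
  proof -
    have "(\<integral>\<^sup>+g. f g \<partial>std_gaussian) = (\<integral>\<^sup>+g. f g \<partial>distr std_gaussian borel V)"
      by (simp add: std_gaussian_distr_orthogonal[OF V])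
    also have "\<dots> = (\<integral>\<^sup>+x. f (V x) \<partial>std_gaussian)"
      by (rule nn_integral_distr) auto
    also have "\<dots> = (\<integral>\<^sup>+x. ennreal (K * exp (- (norm (V x))\<^sup>2 / 2)) * f (V x) \<partial>lborel)"
      unfolding std_gaussian_def by (subst nn_integral_density) (auto simp: std_gaussian_density_eq K_def Vnorm)
    finally show ?thesis .
  qed
  have "(\<integral>\<^sup>+g. h g \<partial>std_gaussian) = (\<integral>\<^sup>+x. ennreal (K * exp (- (norm (V x))\<^sup>2 / 2)) * h (V x) \<partial>lborel)"
    by (rule gauss) measurable
  also have "\<dots> = (\<integral>\<^sup>+x. \<Phi> (V x) \<partial>lborel)"
  proof (rule nn_integral_cong)
    fix x
    have "exp (- (norm (V x))\<^sup>2 / 2) * exp (- ((1 / s\<^sup>2 - 1) * (norm (\<pi> (V x)))\<^sup>2 + (1 / r\<^sup>2 - 1) * (norm (V x - \<pi> (V x)))\<^sup>2) / 2)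
      = exp (- ((norm (\<pi> (V x)))\<^sup>2 / s\<^sup>2 + (norm (V x - \<pi> (V x)))\<^sup>2 / r\<^sup>2) / 2)"
      unfolding exp_add[symmetric] pyth[of "V x"] by (simp add: algebra_simps add_divide_distrib diff_divide_distrib)
    then show "ennreal (K * exp (- (norm (V x))\<^sup>2 / 2)) * h (V x) = \<Phi> (V x)"
      by (simp add: h_def \<Phi>_def ennreal_mult[symmetric] K mult.assoc[symmetric])
         (simp add: K mult.assoc)
  qed
  also have "\<dots> = ennreal (\<Prod>b\<in>Basis. \<bar>if b \<in> S then s else r\<bar>) * (\<integral>\<^sup>+x. \<Phi> (V (D s r x)) \<partial>lborel)"
    unfolding D_def using sr by (intro nn_integral_lborel_diagonal) auto
  also have "(\<integral>\<^sup>+x. \<Phi> (V (D s r x)) \<partial>lborel) = (\<integral>\<^sup>+x. ennreal (K * exp (- (norm (V x))\<^sup>2 / 2)) * indicator R (V x) \<partial>lborel)"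
  proof (rule nn_integral_cong)
    fix x
    show "\<Phi> (V (D s r x)) = ennreal (K * exp (- (norm (V x))\<^sup>2 / 2)) * indicator R (V x)"
    proof (cases "V x \<in> R")
      case True
      have "V (D s r x) - s *\<^sub>R \<pi> (V x) = r *\<^sub>R (V x - \<pi> (V x))"
        by (simp add: VD[OF True])
      then show ?thesis
        using True sr VD_R[OF True sr] unfolding \<Phi>_def VD_\<pi>[OF True sr]
        by (simp add: power_mult_distrib pyth[of "V x"])
    next
      case False
      then show ?thesis by (simp add: \<Phi>_def VD_iff)
    qed
  qed
  also have "\<dots> = (\<integral>\<^sup>+g. indicator R g \<partial>std_gaussian)"
    by (rule gauss[symmetric]) measurable
  also have "\<dots> = emeasure std_gaussian R"
    by simp
  finally show ?thesis
    by (simp add: h_def prod \<pi>_def)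
qed

text \<open>For s = 1 / sqrt (1 + t) and r = 1 this is the Laplace transform E exp (- t X / 2). The
  second parameter weights the residual, so that passing to the polar cone swaps s and r.\<close>

definition steiner_transform :: "'a::euclidean_space set \<Rightarrow> real \<Rightarrow> real \<Rightarrow> real" where
  "steiner_transform C s r = (\<integral>g. exp (- ((1 / s\<^sup>2 - 1) * (norm (closest_point C g))\<^sup>2
      + (1 / r\<^sup>2 - 1) * (norm (g - closest_point C g))\<^sup>2) / 2) \<partial>std_gaussian)"

text \<open>The regions belonging to the faces partition the space. Each contributes its Gaussian
  measure times a factor depending only on the dimension of the face, and grouping by dimension
  gives the intrinsic volumes.\<close>

lemma polyhedral_steiner_formula:
  fixes C :: "'a::euclidean_space set"
  assumes P: "polyhedral_cone C" and sr: "0 < s" "0 < r"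
  shows "steiner_transform C s r = (\<Sum>k\<le>DIM('a). polyhedral_intrinsic_volume C k * s ^ k * r ^ (DIM('a) - k))"
proof -
  note C = closed_polyhedral_cone[OF P] convex_cone_polyhedral_cone[OF P]
  note [measurable] = borel_measurable_closest_point[OF C]
  define \<F> where "\<F> = {F. cone_face C F}"
  define R where "R F = {g. closest_point C g \<in> rel_interior F}" for F
  have fin: "finite \<F>"
    unfolding \<F>_def by (rule finite_cone_faces[OF P])
  have R[measurable]: "R F \<in> sets borel" for F
    unfolding R_def by measurable
  have disj: "disjoint_family_on R \<F>"
    unfolding disjoint_family_on_def R_def \<F>_def
    using cone_face_rel_interior_unique[OF C(2)] by blast
  have cover: "(\<Sum>F\<in>\<F>. indicator (R F) g) = (1 :: ennreal)" for g
  proof -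
    obtain F where F: "F \<in> \<F>" "g \<in> R F"
      using exists_cone_face_rel_interior[OF P closest_point_cone_in[OF C]] by (auto simp: \<F>_def R_def)
    then have "indicator (R G) g = (if G = F then 1 else 0 :: ennreal)" if "G \<in> \<F>" for G
      using disj that by (auto simp: disjoint_family_on_def indicator_def)
    then have "(\<Sum>G\<in>\<F>. indicator (R G) g) = (\<Sum>G\<in>\<F>. if G = F then 1 else 0 :: ennreal)"
      by (intro sum.cong refl)
    then show ?thesis
      using F fin by simp
  qed
  define a where "a k = s ^ k * r ^ (DIM('a) - k)" for k
  have a: "0 \<le> a k" for k
    using sr by (simp add: a_def)
  define e where "e g = exp (- ((1 / s\<^sup>2 - 1) * (norm (closest_point C g))\<^sup>2
      + (1 / r\<^sup>2 - 1) * (norm (g - closest_point C g))\<^sup>2) / 2)" for g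
  have [measurable]: "e \<in> borel_measurable borel"
    unfolding e_def by measurable
  have "(\<integral>\<^sup>+g. ennreal (e g) \<partial>std_gaussian) = (\<integral>\<^sup>+g. (\<Sum>F\<in>\<F>. ennreal (e g) * indicator (R F) g) \<partial>std_gaussian)"
    by (simp add: sum_distrib_left[symmetric] cover)
  also have "\<dots> = (\<Sum>F\<in>\<F>. \<integral>\<^sup>+g. ennreal (e g) * indicator (R F) g \<partial>std_gaussian)"
    by (rule nn_integral_sum) measurable
  also have "\<dots> = (\<Sum>F\<in>\<F>. ennreal (a (dim F) * measure std_gaussian (R F)))"
  proof (rule sum.cong[OF refl])
    fix F assume "F \<in> \<F>"
    then show "(\<integral>\<^sup>+g. ennreal (e g) * indicator (R F) g \<partial>std_gaussian) = ennreal (a (dim F) * measure std_gaussian (R F))"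
      unfolding ennreal_mult[OF a measure_nonneg] unfolding a_def R_def e_def gaussian.emeasure_eq_measure[symmetric]
      by (intro nn_integral_std_gaussian_face_region[OF C _ sr]) (simp add: \<F>_def)
  qed
  also have "\<dots> = ennreal (\<Sum>F\<in>\<F>. a (dim F) * measure std_gaussian (R F))"
    by (simp add: a)
  finally have "(\<integral>g. e g \<partial>std_gaussian) = (\<Sum>F\<in>\<F>. a (dim F) * measure std_gaussian (R F))"
    by (subst integral_eq_nn_integral) (auto simp: e_def a sum_nonneg)
  also have "\<dots> = (\<Sum>k\<le>DIM('a). \<Sum>F\<in>{F\<in>\<F>. dim F = k}. a (dim F) * measure std_gaussian (R F))"
    using fin by (intro sum.group[symmetric]) (auto simp: dim_subset_UNIV)
  also have "\<dots> = (\<Sum>k\<le>DIM('a). polyhedral_intrinsic_volume C k * a k)"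
  proof (rule sum.cong[OF refl])
    fix k
    have "{g. \<exists>F. cone_face C F \<and> dim F = k \<and> closest_point C g \<in> rel_interior F} = (\<Union>F\<in>{F\<in>\<F>. dim F = k}. R F)"
      by (auto simp: \<F>_def R_def)
    then have "polyhedral_intrinsic_volume C k = measure std_gaussian (\<Union>F\<in>{F\<in>\<F>. dim F = k}. R F)"
      by (simp add: polyhedral_intrinsic_volume_def)
    also have "\<dots> = (\<Sum>F\<in>{F\<in>\<F>. dim F = k}. measure std_gaussian (R F))"
      using fin by (intro gaussian.finite_measure_finite_Union)
        (auto intro: disjoint_family_on_mono[OF _ disj])
    finally show "(\<Sum>F\<in>{F\<in>\<F>. dim F = k}. a (dim F) * measure std_gaussian (R F)) = polyhedral_intrinsic_volume C k * a k"
      by (simp add: sum_distrib_left mult.commute)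
  qed
  finally show ?thesis
    by (simp add: steiner_transform_def e_def a_def mult.assoc)
qed

text \<open>The coefficients of a polynomial are recovered from its values on \<open>(0, 1]\<close>:
  \<open>p (t / 2) - 2\<^sup>-\<^sup>d p t\<close> has degree less than \<open>d\<close>, and the remaining coefficients are
  multiplied by nonzero constants.\<close>

lemma polynomial_coefficient_functional:
  "\<exists>\<phi> :: nat \<Rightarrow> (real \<Rightarrow> real) \<Rightarrow> real. \<forall>k\<le>d.
    (\<forall>c. \<phi> k (\<lambda>t. \<Sum>i\<le>d. c i * t ^ i) = c k) \<and>
    (\<forall>q p. (\<forall>t. 0 < t \<longrightarrow> t \<le> 1 \<longrightarrow> (\<lambda>n::nat. q n t) \<longlonglongrightarrow> p t) \<longrightarrow> (\<lambda>n. \<phi> k (q n)) \<longlonglongrightarrow> \<phi> k p)"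
proof (induction d)
  case 0
  show ?case
    by (rule exI[of _ "\<lambda>_ p. p 1"]) simp
next
  case (Suc d)
  then obtain \<phi> :: "nat \<Rightarrow> (real \<Rightarrow> real) \<Rightarrow> real" where
    \<phi>: "\<And>k c. k \<le> d \<Longrightarrow> \<phi> k (\<lambda>t. \<Sum>i\<le>d. c i * t ^ i) = c k" and
    lim: "\<And>k q p. k \<le> d \<Longrightarrow> (\<And>t. 0 < t \<Longrightarrow> t \<le> 1 \<Longrightarrow> (\<lambda>n::nat. q n t) \<longlonglongrightarrow> p t) \<Longrightarrow> (\<lambda>n. \<phi> k (q n)) \<longlonglongrightarrow> \<phi> k p"
    by blast
  \<comment> \<open>The factor by which the coefficient of index k is multiplied; it vanishes at k =
    \<open>Suc d\<close>. Halving t keeps the sample points in (0, 1].\<close>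
  define h where "h k = (1 / 2 :: real) ^ k - (1 / 2) ^ Suc d" for k
  have h: "h k \<noteq> 0" if "k \<le> d" for k
  proof -
    have "(1 / 2 :: real) ^ Suc d < (1 / 2) ^ k"
      using that by (intro power_strict_decreasing) auto
    then show ?thesis by (simp add: h_def)
  qed
  define \<psi> where "\<psi> k p = \<phi> k (\<lambda>t. p (t / 2) - (1 / 2) ^ Suc d * p t) / h k" for k p
  \<comment> \<open>The eliminated top coefficient is recovered from the value at 1, the sum of all
    coefficients.\<close>
  define \<xi> where "\<xi> k p = (if k \<le> d then \<psi> k p else p 1 - (\<Sum>i\<le>d. \<psi> i p))" for k p
  have \<psi>: "\<psi> k (\<lambda>t. \<Sum>i\<le>Suc d. c i * t ^ i) = c k" if "k \<le> d" for k c
  proof -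
    have "(\<Sum>i\<le>Suc d. c i * (t / 2) ^ i) - (1 / 2) ^ Suc d * (\<Sum>i\<le>Suc d. c i * t ^ i)
        = (\<Sum>i\<le>Suc d. (c i * h i) * t ^ i)" for t
      unfolding sum_distrib_left sum_subtractf[symmetric]
      by (intro sum.cong refl) (simp add: h_def power_divide algebra_simps)
    then have "(\<lambda>t. (\<Sum>i\<le>Suc d. c i * (t / 2) ^ i) - (1 / 2) ^ Suc d * (\<Sum>i\<le>Suc d. c i * t ^ i))
        = (\<lambda>t. \<Sum>i\<le>d. (c i * h i) * t ^ i)"
      by (simp add: h_def)
    then show ?thesis
      using h[OF that] \<phi>[OF that, of "\<lambda>i. c i * h i"] by (simp add: \<psi>_def)
  qed
  have \<psi>_lim: "(\<lambda>n. \<psi> k (q n)) \<longlonglongrightarrow> \<psi> k p"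
    if k: "k \<le> d" and q: "\<And>t. 0 < t \<Longrightarrow> t \<le> 1 \<Longrightarrow> (\<lambda>n::nat. q n t) \<longlonglongrightarrow> p t" for k q p
    unfolding \<psi>_def using h[OF k] by (intro tendsto_intros lim k q) auto
  show ?case
  proof (rule exI[of _ \<xi>], intro allI impI conjI)
    fix k and c :: "nat \<Rightarrow> real" assume "k \<le> Suc d"
    then consider "k \<le> d" | "k = Suc d" by linarith
    then show "\<xi> k (\<lambda>t. \<Sum>i\<le>Suc d. c i * t ^ i) = c k"
    proof cases
      case 1
      then show ?thesis by (simp only: \<xi>_def \<psi> if_True)
    next
      case 2
      have "(\<Sum>i\<le>d. \<psi> i (\<lambda>t. \<Sum>i\<le>Suc d. c i * t ^ i)) = (\<Sum>i\<le>d. c i)"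
        by (intro sum.cong refl \<psi>) simp
      then show ?thesis using 2 by (simp add: \<xi>_def)
    qed
  next
    fix k and q :: "nat \<Rightarrow> real \<Rightarrow> real" and p
    assume "\<forall>t. 0 < t \<longrightarrow> t \<le> 1 \<longrightarrow> (\<lambda>n::nat. q n t) \<longlonglongrightarrow> p t"
    then show "(\<lambda>n. \<xi> k (q n)) \<longlonglongrightarrow> \<xi> k p"
      unfolding \<xi>_def by (cases "k \<le> d") (auto intro!: tendsto_intros \<psi>_lim)
  qed
qed

section \<open>Angular distance and the conic Hausdorff metric\<close>

lemma inner_div_norm_bounds:
  fixes x y :: "'a::real_inner"
  shows "- 1 \<le> x \<bullet> y / (norm x * norm y)" "x \<bullet> y / (norm x * norm y) \<le> 1"
proof -
  have "\<bar>x \<bullet> y / (norm x * norm y)\<bar> \<le> 1"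
    using Cauchy_Schwarz_ineq2[of x y] by (cases "x = 0 \<or> y = 0") (auto simp: abs_mult field_simps)
  then show "- 1 \<le> x \<bullet> y / (norm x * norm y)" "x \<bullet> y / (norm x * norm y) \<le> 1"
    by linarith+
qed

lemma dist_s_le_pi: "dist_s x y \<le> pi"
  using pi_ge_zero arccos_ubound[OF inner_div_norm_bounds, of x y] by (simp add: dist_s_def)

lemma dist_s_self [simp]: "dist_s x x = 0"
  by (simp add: dist_s_def power2_norm_eq_inner[symmetric] power2_eq_square[symmetric])

text \<open>The convention that a nonzero vector has distance pi / 2 from 0 rules out y = 0, and the
  cosine is decreasing on the remaining range.\<close>

lemma dist_s_less_pi_half:
  assumes d: "dist_s x y \<le> \<beta>" "\<beta> < pi / 2" and x: "x \<noteq> 0"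
  shows "y \<noteq> 0" and "cos \<beta> * (norm x * norm y) \<le> x \<bullet> y"
proof -
  show y: "y \<noteq> 0"
    using d x by (auto simp: dist_s_def)
  let ?z = "x \<bullet> y / (norm x * norm y)"
  have "arccos ?z \<le> \<beta>"
    using d x y by (simp add: dist_s_def)
  then have "cos \<beta> \<le> cos (arccos ?z)"
    using d(2) pi_gt_zero arccos_lbound[OF inner_div_norm_bounds, of x y]
    by (intro cos_monotone_0_pi_le) auto
  also have "\<dots> = ?z"
    by (rule cos_arccos[OF inner_div_norm_bounds])
  finally show "cos \<beta> * (norm x * norm y) \<le> x \<bullet> y"
    using x y by (simp add: field_simps)
qed

lemma conic_hausdist_lessD:
  fixes C :: "'a::euclidean_space set"
  assumes "conic_hausdist C D < \<alpha>" "C \<noteq> {}" "D \<noteq> {}"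
  obtains \<beta> where "0 \<le> \<beta>" "\<beta> < \<alpha>" "D \<subseteq> angular_nbhd C \<beta>" "C \<subseteq> angular_nbhd D \<beta>"
proof -
  let ?A = "{\<alpha>. 0 \<le> \<alpha> \<and> D \<subseteq> angular_nbhd C \<alpha> \<and> C \<subseteq> angular_nbhd D \<alpha>}"
  \<comment> \<open>No angle exceeds pi, so the infimum runs over a nonempty set.\<close>
  have "pi \<in> ?A"
    using assms(2,3) dist_s_le_pi by (auto simp: angular_nbhd_def)
  then have "?A \<noteq> {}" by blast
  then obtain \<beta> where "\<beta> \<in> ?A" "\<beta> < \<alpha>"
    using assms(1) cInf_lessD[of ?A \<alpha>] unfolding conic_hausdist_def by blast
  then show ?thesis using that by blast
qed

lemma conic_hausdist_nonneg:
  assumes "C \<noteq> {}" "D \<noteq> {}"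
  shows "0 \<le> conic_hausdist C D"
proof -
  have "pi \<in> {\<alpha>. 0 \<le> \<alpha> \<and> D \<subseteq> angular_nbhd C \<alpha> \<and> C \<subseteq> angular_nbhd D \<alpha>}"
    using assms dist_s_le_pi by (auto simp: angular_nbhd_def)
  then show ?thesis
    unfolding conic_hausdist_def by (intro cInf_greatest) auto
qed

lemma conic_hausdist_le:
  assumes "0 \<le> \<alpha>" "D \<subseteq> angular_nbhd C \<alpha>" "C \<subseteq> angular_nbhd D \<alpha>"
  shows "conic_hausdist C D \<le> \<alpha>"
  unfolding conic_hausdist_def using assms by (intro cInf_lower bdd_belowI[of _ 0]) auto

text \<open>A nonzero projection has norm \<open>g \<bullet> u\<close> for its own unit direction u.
  A unit vector v of \<open>D\<close> at angle at most \<beta> from u is at distance at most sqrt (2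
  - 2 cos \<beta>), and \<open>g \<bullet> v\<close> is a lower bound for the norm of the projection
  onto \<open>D\<close>.\<close>

lemma norm_closest_point_angular_nbhd:
  fixes C D :: "'a::euclidean_space set"
  assumes C: "closed C" "convex_cone C" and D: "closed D" "convex_cone D"
    and sub: "C \<subseteq> angular_nbhd D \<beta>" and \<beta>: "0 \<le> \<beta>" "\<beta> < pi / 2"
  shows "norm (closest_point C g) - norm g * sqrt (2 - 2 * cos \<beta>) \<le> norm (closest_point D g)"
proof (cases "closest_point C g = 0")
  case True
  then show ?thesis
    by (simp add: order_trans[OF _ norm_ge_zero] mult_nonneg_nonneg)
next
  case False
  define a where "a = closest_point C g"
  have a: "a \<in> C" "a \<noteq> 0"
    using False closest_point_cone_in[OF C] by (auto simp: a_def)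
  then obtain y where y: "y \<in> D" "dist_s a y \<le> \<beta>"
    using sub by (auto simp: angular_nbhd_def)
  have y0: "y \<noteq> 0" and ay: "cos \<beta> * (norm a * norm y) \<le> a \<bullet> y"
    using dist_s_less_pi_half[OF y(2) \<beta>(2) a(2)] by auto
  define u v where "u = a /\<^sub>R norm a" and "v = y /\<^sub>R norm y"
  have u: "norm u = 1" and v: "norm v = 1"
    using a y0 by (auto simp: u_def v_def)
  have "v \<in> D"
    unfolding v_def using y(1) by (intro convex_cone_scaleR[OF D(2)]) auto
  have "cos \<beta> \<le> u \<bullet> v"
    using ay a y0 by (simp add: u_def v_def field_simps)
  moreover have "(norm (u - v))\<^sup>2 = 2 - 2 * (u \<bullet> v)"
    using u v by (simp add: power2_norm_eq_inner inner_diff inner_commute norm_eq_1)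
  ultimately have "norm (u - v) \<le> sqrt (2 - 2 * cos \<beta>)"
    by (intro real_le_rsqrt) simp
  then have "g \<bullet> (u - v) \<le> norm g * sqrt (2 - 2 * cos \<beta>)"
    by (intro order_trans[OF norm_cauchy_schwarz] mult_left_mono) auto
  moreover have "g \<bullet> u = norm a"
    using inner_closest_point_cone[OF C, of g] a by (simp add: u_def a_def[symmetric] power2_eq_square)
  moreover have "g \<bullet> v \<le> norm (closest_point D g)"
  proof -
    have "g \<bullet> v \<le> closest_point D g \<bullet> v"
      using closest_point_cone_polar[OF D \<open>v \<in> D\<close>, of g] by (simp add: inner_diff_left)
    also have "\<dots> \<le> norm (closest_point D g)"
      using norm_cauchy_schwarz[of "closest_point D g" v] v by simp
    finally show ?thesis .
  qed
  ultimately show ?thesis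
    by (simp add: inner_diff_right a_def)
qed

lemma tendsto_norm_closest_point_hausdist:
  fixes C :: "'a::euclidean_space set"
  assumes C: "closed C" "convex_cone C" and P: "\<And>i::nat. closed (P i)" "\<And>i. convex_cone (P i)"
    and lim: "(\<lambda>i. conic_hausdist (P i) C) \<longlonglongrightarrow> 0"
  shows "(\<lambda>i. norm (closest_point (P i) g)) \<longlonglongrightarrow> norm (closest_point C g)"
proof (rule LIMSEQ_I)
  fix e :: real assume e: "0 < e"
  have "((\<lambda>\<alpha>. norm g * sqrt (2 - 2 * cos \<alpha>)) \<longlongrightarrow> norm g * sqrt (2 - 2 * cos 0)) (at_right 0)"
    by (intro tendsto_intros)
  then have "((\<lambda>\<alpha>. norm g * sqrt (2 - 2 * cos \<alpha>)) \<longlongrightarrow> 0) (at_right 0)"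
    by simp
  then have "eventually (\<lambda>\<alpha>. norm g * sqrt (2 - 2 * cos \<alpha>) < e) (at_right 0)"
    using e by (rule order_tendstoD)
  moreover have "eventually (\<lambda>\<alpha>. \<alpha> \<in> {0<..<pi / 2}) (at_right (0::real))"
    using pi_half_gt_zero by (intro eventually_at_right_real)
  ultimately have "eventually (\<lambda>\<alpha>. norm g * sqrt (2 - 2 * cos \<alpha>) < e \<and> \<alpha> \<in> {0<..<pi / 2}) (at_right 0)"
    by (rule eventually_conj)
  then obtain \<alpha> where \<alpha>: "norm g * sqrt (2 - 2 * cos \<alpha>) < e" "0 < \<alpha>" "\<alpha> < pi / 2"
    using eventually_happens'[of "at_right (0::real)"] by (auto simp: trivial_limit_at_right_real)
  have "eventually (\<lambda>i. conic_hausdist (P i) C < \<alpha>) sequentially"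
    using lim \<alpha>(2) by (rule order_tendstoD)
  then obtain N where N: "\<And>i. i \<ge> N \<Longrightarrow> conic_hausdist (P i) C < \<alpha>"
    by (auto simp: eventually_sequentially)
  show "\<exists>N. \<forall>i\<ge>N. norm (norm (closest_point (P i) g) - norm (closest_point C g)) < e"
  proof (intro exI[of _ N] allI impI)
    fix i assume "N \<le> i"
    then obtain \<beta> where \<beta>: "0 \<le> \<beta>" "\<beta> < \<alpha>" "C \<subseteq> angular_nbhd (P i) \<beta>" "P i \<subseteq> angular_nbhd C \<beta>"
      using conic_hausdist_lessD[OF N] convex_cone_nonempty[OF P(2)] convex_cone_nonempty[OF C(2)] by metis
    have \<beta>pi: "\<beta> < pi / 2" using \<beta> \<alpha> by simp
    have "cos \<alpha> \<le> cos \<beta>"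
      using \<beta> \<alpha> by (intro cos_monotone_0_pi_le) auto
    then have "norm g * sqrt (2 - 2 * cos \<beta>) \<le> norm g * sqrt (2 - 2 * cos \<alpha>)"
      by (intro mult_left_mono real_sqrt_le_mono) auto
    then show "norm (norm (closest_point (P i) g) - norm (closest_point C g)) < e"
      using norm_closest_point_angular_nbhd[OF C P(1,2) \<beta>(3,1) \<beta>pi, of g]
        norm_closest_point_angular_nbhd[OF P(1,2) C \<beta>(4,1) \<beta>pi, of g] \<alpha>(1)
      by (simp add: abs_less_iff)
  qed
qed

text \<open>Outer approximation by the halfspaces given by a finite net of unit vectors of the polar cone.\<close>

lemma polyhedral_cone_approximation:
  fixes C :: "'a::euclidean_space set"
  assumes C: "closed C" "convex_cone C" and \<epsilon>: "0 < \<epsilon>" "\<epsilon> < 1"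
  obtains P where "polyhedral_cone P" "conic_hausdist P C \<le> arccos (sqrt (1 - \<epsilon>\<^sup>2))"
proof -
  define K where "K = polar_cone C \<inter> sphere 0 1"
  have "compact K"
    unfolding K_def by (intro closed_Int_compact closed_polar_cone compact_sphere)
  then obtain N where N: "finite N" "N \<subseteq> K" "K \<subseteq> (\<Union>u\<in>N. ball u \<epsilon>)"
    using seq_compact_imp_totally_bounded[of K] \<epsilon>(1) compact_imp_seq_compact by blast
  \<comment> \<open>Negation turns outer normals into constraints of the form used by
    \<open>polyhedral_cone\<close>.\<close>
  define P where "P = (\<Inter>u\<in>uminus ` N. {x. 0 \<le> u \<bullet> x})"
  have P: "polyhedral_cone P"
    unfolding polyhedral_cone_def P_def using N(1) by blast
  have CP: "C \<subseteq> P"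
    using N(2) by (auto simp: P_def K_def polar_cone_def)
  \<comment> \<open>The angle with sine \<epsilon>: below, the residual b of a point x of
    \<open>P\<close> is shown to have norm at most \<epsilon> |x|.\<close>
  define \<alpha> where "\<alpha> = arccos (sqrt (1 - \<epsilon>\<^sup>2))"
  have \<epsilon>2: "\<epsilon>\<^sup>2 < 1"
    using \<epsilon> by (simp add: power_less_one_iff)
  have sq: "0 \<le> sqrt (1 - \<epsilon>\<^sup>2)" "sqrt (1 - \<epsilon>\<^sup>2) \<le> 1"
    using \<epsilon>2 by auto
  have \<alpha>: "0 \<le> \<alpha>"
    unfolding \<alpha>_def using sq by (intro arccos_lbound order_trans[OF _ sq(1)]) auto
  have "x \<in> angular_nbhd C \<alpha>" if x: "x \<in> P" for x
  proof (cases "x = 0")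
    case True
    then show ?thesis
      using convex_cone_contains_0[OF C(2)] \<alpha> by (auto simp: angular_nbhd_def intro!: bexI[of _ 0])
  next
    case False
    define a b where "a = closest_point C x" and "b = x - a"
    have ax: "x \<bullet> a = (norm a)\<^sup>2" and pyth: "(norm x)\<^sup>2 = (norm a)\<^sup>2 + (norm b)\<^sup>2"
      using inner_closest_point_cone[OF C, of x] norm_closest_point_cone_pythagoras[OF C, of x]
      by (simp_all add: a_def b_def)
    have "b \<bullet> a = 0" "x = a + b"
      using closest_point_cone_orthogonal[OF C, of x] by (simp_all add: a_def b_def)
    then have bx: "b \<bullet> x = (norm b)\<^sup>2"
      by (simp add: inner_add_right power2_norm_eq_inner)
    have "norm b \<le> \<epsilon> * norm x"
    proof (cases "b = 0")
      case True
      then show ?thesis using \<epsilon> by simp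
    next
      case b0: False
      have "b \<in> polar_cone C"
        using closest_point_cone_polar[OF C, of _ x] by (auto simp: polar_cone_def b_def a_def)
      then have "b /\<^sub>R norm b \<in> K"
        using b0 by (auto simp: K_def intro!: convex_cone_scaleR[OF convex_cone_polar_cone])
      then obtain u where u: "u \<in> N" "norm (u - b /\<^sub>R norm b) < \<epsilon>"
        using N(3) by (force simp: dist_norm)
      have ux: "u \<bullet> x \<le> 0"
        using x u(1) by (auto simp: P_def)
      have "norm b = (b /\<^sub>R norm b) \<bullet> x"
        using b0 by (simp add: bx power2_eq_square)
      also have "\<dots> \<le> (b /\<^sub>R norm b - u) \<bullet> x"
        using ux by (simp add: inner_diff_left)
      also have "\<dots> \<le> norm (b /\<^sub>R norm b - u) * norm x"
        by (rule norm_cauchy_schwarz)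
      also have "\<dots> \<le> \<epsilon> * norm x"
        using u(2) by (intro mult_right_mono) (auto simp: norm_minus_commute)
      finally show ?thesis .
    qed
    then have "(norm b)\<^sup>2 \<le> \<epsilon>\<^sup>2 * (norm x)\<^sup>2"
      unfolding power_mult_distrib[symmetric] by (intro power_mono) auto
    then have "(1 - \<epsilon>\<^sup>2) * (norm x)\<^sup>2 \<le> (norm a)\<^sup>2"
      using pyth by (simp add: algebra_simps)
    then have "sqrt ((1 - \<epsilon>\<^sup>2) * (norm x)\<^sup>2) \<le> sqrt ((norm a)\<^sup>2)"
      by (rule real_sqrt_le_mono)
    then have le: "sqrt (1 - \<epsilon>\<^sup>2) * norm x \<le> norm a"
      by (simp add: real_sqrt_mult)
    have a0: "a \<noteq> 0"
    proof
      assume "a = 0"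
      then have "sqrt (1 - \<epsilon>\<^sup>2) * norm x \<le> 0" using le by simp
      moreover have "0 < sqrt (1 - \<epsilon>\<^sup>2) * norm x" using False \<epsilon>2 by simp
      ultimately show False by simp
    qed
    have "dist_s x a = arccos (norm a / norm x)"
      using False a0 by (simp add: dist_s_def ax power2_eq_square)
    also have "\<dots> \<le> \<alpha>"
      unfolding \<alpha>_def
    proof (rule arccos_le_arccos)
      show "- 1 \<le> sqrt (1 - \<epsilon>\<^sup>2)" by (rule order_trans[OF _ sq(1)]) simp
      show "sqrt (1 - \<epsilon>\<^sup>2) \<le> norm a / norm x"
        using le False by (simp add: field_simps)
      show "norm a / norm x \<le> 1"
        using norm_closest_point_cone_le[OF C, of x] False by (simp add: a_def)
    qed
    finally show ?thesis
      using closest_point_cone_in[OF C, of x] by (auto simp: angular_nbhd_def a_def)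
  qed
  moreover have "C \<subseteq> angular_nbhd P \<alpha>"
    using CP \<alpha> by (force simp: angular_nbhd_def)
  ultimately have "conic_hausdist P C \<le> \<alpha>"
    using \<alpha> by (intro conic_hausdist_le) auto
  then show ?thesis
    using that P by (simp add: \<alpha>_def)
qed

lemma polyhedral_cones_dense:
  fixes C :: "'a::euclidean_space set"
  assumes C: "closed C" "convex_cone C"
  obtains P where "\<And>i::nat. polyhedral_cone (P i)" "(\<lambda>i. conic_hausdist (P i) C) \<longlonglongrightarrow> 0"
proof -
  \<comment> \<open>The double successor keeps every value strictly below 1.\<close>
  define \<epsilon> where "\<epsilon> i = inverse (real (Suc (Suc i)))" for i
  have \<epsilon>: "0 < \<epsilon> i" "\<epsilon> i < 1" for i
    by (auto simp: \<epsilon>_def field_simps)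
  have "\<exists>P. polyhedral_cone P \<and> conic_hausdist P C \<le> arccos (sqrt (1 - (\<epsilon> i)\<^sup>2))" for i
    by (rule polyhedral_cone_approximation[OF C \<epsilon>]) blast
  then obtain P where P: "\<And>i. polyhedral_cone (P i)" "\<And>i. conic_hausdist (P i) C \<le> arccos (sqrt (1 - (\<epsilon> i)\<^sup>2))"
    by metis
  have "\<epsilon> \<longlonglongrightarrow> 0"
    unfolding \<epsilon>_def using LIMSEQ_Suc[OF LIMSEQ_inverse_real_of_nat] .
  then have "(\<lambda>i. sqrt (1 - (\<epsilon> i)\<^sup>2)) \<longlonglongrightarrow> sqrt (1 - 0\<^sup>2)"
    by (intro tendsto_intros)
  then have lim1: "(\<lambda>i. sqrt (1 - (\<epsilon> i)\<^sup>2)) \<longlonglongrightarrow> 1"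
    by simp
  have in1: "sqrt (1 - (\<epsilon> i)\<^sup>2) \<in> {- 1..1}" for i
  proof -
    have "(\<epsilon> i)\<^sup>2 < 1"
      using \<epsilon>[of i] by (simp add: power_less_one_iff)
    then have "0 \<le> sqrt (1 - (\<epsilon> i)\<^sup>2)" by simp
    then have "- 1 \<le> sqrt (1 - (\<epsilon> i)\<^sup>2)" by linarith
    then show ?thesis by simp
  qed
  have "(\<lambda>i. arccos (sqrt (1 - (\<epsilon> i)\<^sup>2))) \<longlonglongrightarrow> arccos 1"
    by (rule continuous_on_tendsto_compose[OF continuous_on_arccos' lim1]) (use in1 in auto)
  then have "(\<lambda>i. arccos (sqrt (1 - (\<epsilon> i)\<^sup>2))) \<longlonglongrightarrow> 0"
    by simp
  then have "(\<lambda>i. conic_hausdist (P i) C) \<longlonglongrightarrow> 0"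
    by (rule tendsto_sandwich[OF _ _ tendsto_const, rotated 2])
       (auto intro!: always_eventually conic_hausdist_nonneg P(2)
         convex_cone_nonempty convex_cone_polyhedral_cone P(1) C)
  then show ?thesis
    using that P(1) by blast
qed

section \<open>Intrinsic volumes of general cones\<close>

text \<open>The limit is the generalised binomial coefficient of - x / 2 over 2.\<close>

lemma powr_second_order_limit:
  fixes x :: real
  assumes "0 < x"
  shows "((\<lambda>t. ((1 + t) powr (- x / 2) - 1 + x * t / 2) / t\<^sup>2) \<longlongrightarrow> x * (x + 2) / 8) (at_right 0)"
proof -
  have "x * (x + 2) / 8 = - ((- (x / 2) - 1) * x / 4)"
    by (simp add: field_simps)
  then show ?thesis
    using assms by (simp only:) real_asymp
qed

text \<open>Both parameters are at most 1, so the exponent is nonpositive and 1 dominates.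
  Pointwise, convergence of the norms of the projections is enough, as Pythagoras expresses the
  residual through them.\<close>

lemma tendsto_steiner_transform:
  fixes C :: "'a::euclidean_space set"
  assumes C: "closed C" "convex_cone C" and P: "\<And>i::nat. closed (P i)" "\<And>i. convex_cone (P i)"
    and lim: "(\<lambda>i. conic_hausdist (P i) C) \<longlonglongrightarrow> 0"
    and s: "0 < s" "s \<le> 1" and r: "0 < r" "r \<le> 1"
  shows "(\<lambda>i. steiner_transform (P i) s r) \<longlonglongrightarrow> steiner_transform C s r"
  unfolding steiner_transform_def
proof (rule integral_dominated_convergence[where w = "\<lambda>_. 1"])
  have [measurable]: "closest_point (P i) \<in> borel_measurable borel" "closest_point C \<in> borel_measurable borel" for i
    by (auto intro!: borel_measurable_closest_point C P)
  show "(\<lambda>g. exp (- ((1 / s\<^sup>2 - 1) * (norm (closest_point C g))\<^sup>2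
      + (1 / r\<^sup>2 - 1) * (norm (g - closest_point C g))\<^sup>2) / 2)) \<in> borel_measurable std_gaussian"
    by measurable
  show "(\<lambda>g. exp (- ((1 / s\<^sup>2 - 1) * (norm (closest_point (P i) g))\<^sup>2
      + (1 / r\<^sup>2 - 1) * (norm (g - closest_point (P i) g))\<^sup>2) / 2)) \<in> borel_measurable std_gaussian" for i
    by measurable
  have le1: "norm (exp (- q / 2)) \<le> 1" if "0 \<le> q" for q :: real
    using that by simp
  have "0 \<le> 1 / s\<^sup>2 - 1" "0 \<le> 1 / r\<^sup>2 - 1"
    using s r by (auto simp: field_simps power_le_one)
  then have "0 \<le> (1 / s\<^sup>2 - 1) * (norm (closest_point (P i) g))\<^sup>2
      + (1 / r\<^sup>2 - 1) * (norm (g - closest_point (P i) g))\<^sup>2" for i g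
    by (intro add_nonneg_nonneg mult_nonneg_nonneg) auto
  then show "AE g in std_gaussian. norm (exp (- ((1 / s\<^sup>2 - 1) * (norm (closest_point (P i) g))\<^sup>2
      + (1 / r\<^sup>2 - 1) * (norm (g - closest_point (P i) g))\<^sup>2) / 2)) \<le> 1" for i
    using le1 by (intro AE_I2) blast
  show "AE g in std_gaussian. (\<lambda>i. exp (- ((1 / s\<^sup>2 - 1) * (norm (closest_point (P i) g))\<^sup>2
      + (1 / r\<^sup>2 - 1) * (norm (g - closest_point (P i) g))\<^sup>2) / 2))
      \<longlonglongrightarrow> exp (- ((1 / s\<^sup>2 - 1) * (norm (closest_point C g))\<^sup>2
      + (1 / r\<^sup>2 - 1) * (norm (g - closest_point C g))\<^sup>2) / 2)"
  proof (intro AE_I2)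
    fix g :: 'a
    note n = tendsto_norm_closest_point_hausdist[OF C P lim, of g]
    have eq: "(norm (g - closest_point D g))\<^sup>2 = (norm g)\<^sup>2 - (norm (closest_point D g))\<^sup>2"
      if "closed D" "convex_cone D" for D
      using norm_closest_point_cone_pythagoras[OF that, of g] by simp
    show "(\<lambda>i. exp (- ((1 / s\<^sup>2 - 1) * (norm (closest_point (P i) g))\<^sup>2
      + (1 / r\<^sup>2 - 1) * (norm (g - closest_point (P i) g))\<^sup>2) / 2))
      \<longlonglongrightarrow> exp (- ((1 / s\<^sup>2 - 1) * (norm (closest_point C g))\<^sup>2
      + (1 / r\<^sup>2 - 1) * (norm (g - closest_point C g))\<^sup>2) / 2)"
      unfolding eq[OF C] eq[OF P] by (intro tendsto_intros n) simp
  qed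
qed simp

lemma polynomial_coefficient_functional_at:
  assumes "k \<le> d"
  obtains \<phi> :: "(real \<Rightarrow> real) \<Rightarrow> real" where "\<And>c. \<phi> (\<lambda>t. \<Sum>i\<le>d. c i * t ^ i) = c k"
    "\<And>q p. (\<And>t. 0 < t \<Longrightarrow> t \<le> 1 \<Longrightarrow> (\<lambda>n::nat. q n t) \<longlonglongrightarrow> p t) \<Longrightarrow> (\<lambda>n. \<phi> (q n)) \<longlonglongrightarrow> \<phi> p"
proof -
  obtain \<Phi> :: "nat \<Rightarrow> (real \<Rightarrow> real) \<Rightarrow> real" where \<Phi>: "\<forall>k\<le>d.
    (\<forall>c. \<Phi> k (\<lambda>t. \<Sum>i\<le>d. c i * t ^ i) = c k) \<and>
    (\<forall>q p. (\<forall>t. 0 < t \<longrightarrow> t \<le> 1 \<longrightarrow> (\<lambda>n::nat. q n t) \<longlonglongrightarrow> p t) \<longrightarrow> (\<lambda>n. \<Phi> k (q n)) \<longlonglongrightarrow> \<Phi> k p)"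
    using polynomial_coefficient_functional by blast
  show thesis
    by (rule that[of "\<Phi> k"]) (use \<Phi> assms in blast)+
qed

lemma polynomial_coefficients_eq:
  fixes c c' :: "nat \<Rightarrow> real"
  assumes eq: "\<And>t. 0 < t \<Longrightarrow> t \<le> 1 \<Longrightarrow> (\<Sum>i\<le>d. c i * t ^ i) = (\<Sum>i\<le>d. c' i * t ^ i)" and k: "k \<le> d"
  shows "c k = c' k"
proof -
  obtain \<phi> :: "(real \<Rightarrow> real) \<Rightarrow> real" where \<phi>: "\<And>c. \<phi> (\<lambda>t. \<Sum>i\<le>d. c i * t ^ i) = c k" and
    lim: "\<And>q p. (\<And>t. 0 < t \<Longrightarrow> t \<le> 1 \<Longrightarrow> (\<lambda>n::nat. q n t) \<longlonglongrightarrow> p t) \<Longrightarrow> (\<lambda>n. \<phi> (q n)) \<longlonglongrightarrow> \<phi> p"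
    by (rule polynomial_coefficient_functional_at[OF k]) blast
  \<comment> \<open>The two polynomials are only known to agree on (0, 1]. A constant sequence fed
    into the continuity property carries the equality over to the coefficients.\<close>
  have "(\<lambda>n::nat. \<phi> (\<lambda>t. \<Sum>i\<le>d. c i * t ^ i)) \<longlonglongrightarrow> \<phi> (\<lambda>t. \<Sum>i\<le>d. c' i * t ^ i)"
    by (rule lim) (simp add: eq)
  then show ?thesis
    by (simp add: \<phi> LIMSEQ_const_iff)
qed

text \<open>The coefficient functional applied to the Steiner transform of \<open>C\<close> is the
  limit along every approximating sequence, and \<open>P\<close> itself shows that no other value
  qualifies; this settles the \<open>THE\<close>. For polyhedral \<open>C\<close> it agrees with the
  direct definition.\<close>

lemma tendsto_conic_intrinsic_volume:
  fixes C :: "'a::euclidean_space set"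
  assumes C: "closed C" "convex_cone C" and P: "\<And>i. polyhedral_cone (P i)"
    and lim: "(\<lambda>i. conic_hausdist (P i) C) \<longlonglongrightarrow> 0" and k: "k \<le> DIM('a)"
  shows "(\<lambda>i. polyhedral_intrinsic_volume (P i) k) \<longlonglongrightarrow> conic_intrinsic_volume C k"
proof -
  let ?d = "DIM('a)"
  obtain \<phi> :: "(real \<Rightarrow> real) \<Rightarrow> real" where \<phi>: "\<And>c. \<phi> (\<lambda>t. \<Sum>i\<le>?d. c i * t ^ i) = c k" and
    \<phi>_lim: "\<And>q p. (\<And>t. 0 < t \<Longrightarrow> t \<le> 1 \<Longrightarrow> (\<lambda>n::nat. q n t) \<longlonglongrightarrow> p t) \<Longrightarrow> (\<lambda>n. \<phi> (q n)) \<longlonglongrightarrow> \<phi> p"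
    by (rule polynomial_coefficient_functional_at[OF k]) blast
  have poly: "polyhedral_intrinsic_volume Q k = \<phi> (\<lambda>t. steiner_transform Q t 1)" if Q: "polyhedral_cone Q" for Q :: "'a set"
  proof -
    have "(\<lambda>n::nat. \<phi> (\<lambda>t. \<Sum>i\<le>?d. polyhedral_intrinsic_volume Q i * t ^ i)) \<longlonglongrightarrow> \<phi> (\<lambda>t. steiner_transform Q t 1)"
      by (rule \<phi>_lim) (simp add: polyhedral_steiner_formula[OF Q])
    then show ?thesis
      by (simp add: \<phi> LIMSEQ_const_iff)
  qed
  have conv: "(\<lambda>i. polyhedral_intrinsic_volume (Q i) k) \<longlonglongrightarrow> \<phi> (\<lambda>t. steiner_transform C t 1)"
    if Q: "\<And>i. polyhedral_cone (Q i)" and "(\<lambda>i. conic_hausdist (Q i) C) \<longlonglongrightarrow> 0" for Q :: "nat \<Rightarrow> 'a set"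
    unfolding poly[OF Q] using that
    by (intro \<phi>_lim tendsto_steiner_transform C closed_polyhedral_cone convex_cone_polyhedral_cone) auto
  have "conic_intrinsic_volume C k = \<phi> (\<lambda>t. steiner_transform C t 1)"
  proof (cases "polyhedral_cone C")
    case True
    then show ?thesis by (simp add: conic_intrinsic_volume_def poly)
  next
    case False
    have "(THE v. \<forall>P. (\<forall>i. polyhedral_cone (P i)) \<and> (\<lambda>i. conic_hausdist (P i) C) \<longlonglongrightarrow> 0
                  \<longrightarrow> (\<lambda>i. polyhedral_intrinsic_volume (P i) k) \<longlonglongrightarrow> v) = \<phi> (\<lambda>t. steiner_transform C t 1)"
    proof (rule the_equality)
      fix v assume "\<forall>P. (\<forall>i. polyhedral_cone (P i)) \<and> (\<lambda>i. conic_hausdist (P i) C) \<longlonglongrightarrow> 0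
                  \<longrightarrow> (\<lambda>i. polyhedral_intrinsic_volume (P i) k) \<longlonglongrightarrow> v"
      then show "v = \<phi> (\<lambda>t. steiner_transform C t 1)"
        using LIMSEQ_unique[OF _ conv[OF P lim]] P lim by simp
    qed (use conv in blast)
    then show ?thesis
      using False by (simp add: conic_intrinsic_volume_def)
  qed
  then show ?thesis
    using conv[OF P lim] by simp
qed

lemma conic_steiner_formula:
  fixes C :: "'a::euclidean_space set"
  assumes C: "closed C" "convex_cone C" and s: "0 < s" "s \<le> 1" and r: "0 < r" "r \<le> 1"
  shows "steiner_transform C s r = (\<Sum>k\<le>DIM('a). conic_intrinsic_volume C k * s ^ k * r ^ (DIM('a) - k))"
proof -
  obtain P where P: "\<And>i::nat. polyhedral_cone (P i)" and lim: "(\<lambda>i. conic_hausdist (P i) C) \<longlonglongrightarrow> 0"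
    using polyhedral_cones_dense[OF C] by blast
  have "(\<lambda>i. steiner_transform (P i) s r) \<longlonglongrightarrow> steiner_transform C s r"
    by (intro tendsto_steiner_transform C lim s r closed_polyhedral_cone convex_cone_polyhedral_cone P)
  moreover have "(\<lambda>i. steiner_transform (P i) s r) \<longlonglongrightarrow> (\<Sum>k\<le>DIM('a). conic_intrinsic_volume C k * s ^ k * r ^ (DIM('a) - k))"
    unfolding polyhedral_steiner_formula[OF P s(1) r(1)]
    by (intro tendsto_intros tendsto_conic_intrinsic_volume[OF C P lim]) simp
  ultimately show ?thesis
    by (rule LIMSEQ_unique)
qed

lemma conic_intrinsic_volume_nonneg:
  fixes C :: "'a::euclidean_space set"
  assumes C: "closed C" "convex_cone C" and k: "k \<le> DIM('a)"
  shows "0 \<le> conic_intrinsic_volume C k"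
proof -
  obtain P where P: "\<And>i::nat. polyhedral_cone (P i)" and lim: "(\<lambda>i. conic_hausdist (P i) C) \<longlonglongrightarrow> 0"
    using polyhedral_cones_dense[OF C] by blast
  show ?thesis
    by (rule LIMSEQ_le_const[OF tendsto_conic_intrinsic_volume[OF C P lim k]])
       (simp add: polyhedral_intrinsic_volume_def)
qed

lemma sum_conic_intrinsic_volume:
  fixes C :: "'a::euclidean_space set"
  assumes C: "closed C" "convex_cone C"
  shows "(\<Sum>k\<le>DIM('a). conic_intrinsic_volume C k) = 1"
  using conic_steiner_formula[OF C, of 1 1] by (simp add: steiner_transform_def)

text \<open>Moreau's decomposition exchanges projection and residual, hence the two parameters of
  the Steiner transform; comparing coefficients reverses the order.\<close>

lemma conic_intrinsic_volume_polar_cone: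
  fixes C :: "'a::euclidean_space set"
  assumes C: "closed C" "convex_cone C" and k: "k \<le> DIM('a)"
  shows "conic_intrinsic_volume (polar_cone C) k = conic_intrinsic_volume C (DIM('a) - k)"
proof (rule polynomial_coefficients_eq[OF _ k])
  fix t :: real assume t: "0 < t" "t \<le> 1"
  have "(\<Sum>i\<le>DIM('a). conic_intrinsic_volume (polar_cone C) i * t ^ i) = steiner_transform (polar_cone C) t 1"
    using t by (simp add: conic_steiner_formula[OF closed_polar_cone convex_cone_polar_cone])
  also have "\<dots> = steiner_transform C 1 t"
    by (simp add: steiner_transform_def closest_point_polar_cone[OF C])
  also have "\<dots> = (\<Sum>i\<le>DIM('a). conic_intrinsic_volume C i * t ^ (DIM('a) - i))"
    using t by (simp add: conic_steiner_formula[OF C])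
  also have "\<dots> = (\<Sum>i\<le>DIM('a). conic_intrinsic_volume C (DIM('a) - i) * t ^ i)"
    by (rule sum.reindex_bij_witness[of _ "\<lambda>i. DIM('a) - i" "\<lambda>i. DIM('a) - i"]) auto
  finally show "(\<Sum>i\<le>DIM('a). conic_intrinsic_volume (polar_cone C) i * t ^ i) = (\<Sum>i\<le>DIM('a). conic_intrinsic_volume C (DIM('a) - i) * t ^ i)" .
qed

text \<open>Nonnegativity and total mass 1 make \<open>embed_pmf\<close> return the intended
  weights.\<close>

lemma expectation_intrinsic_volume_pmf:
  fixes C :: "'a::euclidean_space set" and f :: "nat \<Rightarrow> real"
  assumes C: "closed C" "convex_cone C"
  shows "measure_pmf.expectation (intrinsic_volume_pmf C) f = (\<Sum>k\<le>DIM('a). conic_intrinsic_volume C k * f k)"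
proof -
  let ?v = "\<lambda>k. if k \<le> DIM('a) then conic_intrinsic_volume C k else 0"
  have nn: "0 \<le> ?v k" for k
    using conic_intrinsic_volume_nonneg[OF C] by simp
  have "(\<integral>\<^sup>+k. ennreal (?v k) \<partial>count_space UNIV) = (\<Sum>k\<le>DIM('a). ennreal (?v k))"
    by (rule nn_integral_count_space') auto
  also have "\<dots> = ennreal (\<Sum>k\<le>DIM('a). ?v k)"
    by (rule sum_ennreal) (rule nn)
  also have "\<dots> = 1"
    using sum_conic_intrinsic_volume[OF C] by simp
  finally have pmf: "pmf (intrinsic_volume_pmf C) k = ?v k" for k
    unfolding intrinsic_volume_pmf_def using nn by (intro pmf_embed_pmf) auto
  have "measure_pmf.expectation (intrinsic_volume_pmf C) f = (\<Sum>k\<le>DIM('a). pmf (intrinsic_volume_pmf C) k *\<^sub>R f k)"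
    by (rule integral_measure_pmf) (auto simp: set_pmf_iff pmf split: if_splits)
  then show ?thesis
    by (simp add: pmf)
qed

section \<open>The Poincare inequality for the Steiner transform\<close>

text \<open>With y = t u^2 / 2 the derivative has absolute value t |u| exp (- y). The bounds |u|
  \<le> 1 + u^2 and y exp (- y) \<le> 1 give t + 2, a crude constant that does not enter the
  Poincare bound.\<close>

lemma exp_neg_square_lipschitz:
  fixes t a b :: real
  assumes t: "0 \<le> t"
  shows "\<bar>exp (- (t * a\<^sup>2) / 2) - exp (- (t * b\<^sup>2) / 2)\<bar> \<le> (t + 2) * \<bar>a - b\<bar>"
proof -
  have "norm (exp (- (t * a\<^sup>2) / 2) - exp (- (t * b\<^sup>2) / 2)) \<le> (t + 2) * norm (a - b)"
  proof (rule field_differentiable_bound[of UNIV _ "\<lambda>u. - (t * u) * exp (- (t * u\<^sup>2) / 2)"])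
    fix u :: real
    show "((\<lambda>u. exp (- (t * u\<^sup>2) / 2)) has_field_derivative - (t * u) * exp (- (t * u\<^sup>2) / 2)) (at u within UNIV)"
      by (auto intro!: derivative_eq_intros simp: power2_eq_square)
    define y where "y = t * u\<^sup>2 / 2"
    have y: "0 \<le> y" using t by (simp add: y_def)
    have "y * exp (- y) \<le> 1"
      using order_trans[OF _ exp_ge_add_one_self, of y y] by (simp add: exp_minus field_simps)
    have e: "exp (- y) \<le> 1" using y by simp
    have "\<bar>u\<bar> \<le> 1 + u\<^sup>2"
      using zero_le_power2[of "\<bar>u\<bar> - 1 / 2"] by (simp add: power2_diff power_divide)
    then have "t * \<bar>u\<bar> \<le> t * (1 + u\<^sup>2)"
      using t by (rule mult_left_mono)
    then have "t * \<bar>u\<bar> * exp (- y) \<le> (t + 2 * y) * exp (- y)"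
      by (intro mult_right_mono) (simp_all add: y_def algebra_simps)
    also have "\<dots> \<le> t * 1 + 2 * 1"
      using \<open>y * exp (- y) \<le> 1\<close> mult_left_mono[OF e t] by (simp add: algebra_simps)
    finally show "norm (- (t * u) * exp (- (t * u\<^sup>2) / 2)) \<le> t + 2"
      using t by (simp add: y_def abs_mult)
  qed auto
  then show ?thesis by simp
qed

text \<open>The Gaussian Poincare inequality for \<open>exp (- t * (norm (closest_point C x))\<^sup>2 / 2)\<close>, whose
  gradient at \<open>x\<close> is \<open>- t * exp (- t * (norm (closest_point C x))\<^sup>2 / 2) *\<^sub>R closest_point C x\<close>.\<close>

lemma steiner_transform_poincare:
  fixes C :: "(real ^ 'n) set"
  assumes C: "closed C" "convex_cone C" and t: "0 < t"
  shows "steiner_transform C (1 / sqrt (1 + 2 * t)) 1 - (steiner_transform C (1 / sqrt (1 + t)) 1)\<^sup>2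
    \<le> t * (1 - steiner_transform C (1 / sqrt (1 + 2 * t)) 1)"
proof -
  note [measurable] = borel_measurable_closest_point[OF C]
  define X where "X x = (norm (closest_point C x))\<^sup>2" for x
  define f where "f x = exp (- (t * X x) / 2)" for x
  define D where "D x = (- t * f x) *\<^sub>R closest_point C x" for x
  have [measurable]: "X \<in> borel_measurable borel" "f \<in> borel_measurable borel" "D \<in> borel_measurable borel"
    unfolding X_def f_def D_def by measurable
  have st: "steiner_transform C (1 / sqrt (1 + u)) 1 = (\<integral>x. exp (- (u * X x) / 2) \<partial>std_gaussian)" if "0 < u" for u
    using that by (simp add: steiner_transform_def X_def power_divide)
  have f2: "(f x)\<^sup>2 = exp (- (2 * t * X x) / 2)" for x
    by (simp add: f_def power2_eq_square exp_add[symmetric])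
  have f1: "\<bar>f x\<bar> \<le> 1" for x
    using t by (simp add: f_def X_def)
  have "(\<integral>x. (f x)\<^sup>2 \<partial>std_gaussian) - (\<integral>x. f x \<partial>std_gaussian)\<^sup>2 \<le> (\<integral>x. (norm (D x))\<^sup>2 \<partial>std_gaussian)"
  proof (rule std_gaussian_poincare[OF _ f1])
    fix x y
    have "\<bar>f x - f y\<bar> \<le> (t + 2) * \<bar>norm (closest_point C x) - norm (closest_point C y)\<bar>"
      unfolding f_def X_def using t by (intro exp_neg_square_lipschitz) simp
    also have "\<dots> \<le> (t + 2) * norm (x - y)"
      using t by (intro mult_left_mono order_trans[OF norm_triangle_ineq3 dist_closest_point_cone_le[OF C]]) auto
    finally show "\<bar>f x - f y\<bar> \<le> (t + 2) * norm (x - y)" .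
    show "(f has_derivative (\<lambda>h. D x \<bullet> h)) (at x)"
      unfolding f_def D_def X_def
      by (rule derivative_eq_intros has_derivative_norm_closest_point_cone[OF C] refl)+ (auto simp: fun_eq_iff)
  qed measurable
  also have "\<dots> \<le> (\<integral>x. t * (1 - (f x)\<^sup>2) \<partial>std_gaussian)"
  proof (rule Bochner_Integration.integral_mono')
    show "integrable std_gaussian (\<lambda>x. t * (1 - (f x)\<^sup>2))"
      using t by (intro gaussian.integrable_const_bound[of _ t] AE_I2) (auto simp: f2 X_def)
    fix x
    define y where "y = t * X x"
    have "(norm (D x))\<^sup>2 = t * (y * exp (- y))"
      by (simp add: D_def power_mult_distrib f2 y_def power2_eq_square[of t] X_def)
    \<comment> \<open>Equivalent to 1 + y \<le> exp y. It replaces the factor \<open>X\<close> in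
      the squared gradient, so the result involves only the Steiner transform and not its
      derivative.\<close>
    also have "y * exp (- y) \<le> 1 - exp (- y)"
      using exp_ge_add_one_self[of y] by (simp add: exp_minus field_simps)
    finally show "(norm (D x))\<^sup>2 \<le> t * (1 - (f x)\<^sup>2)"
      using t by (simp add: f2 y_def)
    show "0 \<le> t * (1 - (f x)\<^sup>2)"
      using t by (simp add: f2 X_def)
  qed
  also have "\<dots> = t * (1 - (\<integral>x. (f x)\<^sup>2 \<partial>std_gaussian))"
  proof -
    have "integrable std_gaussian (\<lambda>x. (f x)\<^sup>2)"
      using t by (intro gaussian.integrable_const_bound[of _ 1] AE_I2) (auto simp: f2 X_def)
    then show ?thesis by simp
  qed
  finally show ?thesis
    using t st[of t] st[of "2 * t"] by (simp add: f2) (simp add: f_def)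
qed

section \<open>The variance bound\<close>

text \<open>Write \<delta> for the mean and m for the second moment. Then G t = 1 - \<delta> t / 2 +
  Q t^2 + o(t^2) with 8 Q = m + 2 \<delta>, and the terms of order t^2 in the hypothesis give 2 Q -
  \<delta>^2 / 4 \<le> \<delta>.\<close>

lemma variance_le_of_generating_function:
  fixes v :: "nat \<Rightarrow> real" and d :: nat
  defines "G \<equiv> \<lambda>t. \<Sum>k\<le>d. v k * (1 + t) powr (- real k / 2)"
  assumes sum1: "(\<Sum>k\<le>d. v k) = 1"
    and ineq: "\<And>t. 0 < t \<Longrightarrow> G (2 * t) - (G t)\<^sup>2 \<le> t * (1 - G (2 * t))"
  shows "(\<Sum>k\<le>d. v k * (real k)\<^sup>2) - (\<Sum>k\<le>d. v k * real k)\<^sup>2 \<le> 2 * (\<Sum>k\<le>d. v k * real k)"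
proof -
  define \<delta> where "\<delta> = (\<Sum>k\<le>d. v k * real k)"
  \<comment> \<open>The second-order remainder divided by t^2. This makes the expansion of
    \<open>G\<close> an exact identity, with the asymptotics confined to the limit of
    \<open>A\<close>.\<close>
  define a where "a k t = ((1 + t) powr (- real k / 2) - 1 + real k * t / 2) / t\<^sup>2" for k t
  define A where "A t = (\<Sum>k\<le>d. v k * a k t)" for t
  define Q where "Q = (\<Sum>k\<le>d. v k * (real k * (real k + 2) / 8))"
  have a_lim: "(a k \<longlongrightarrow> real k * (real k + 2) / 8) (at_right 0)" for k
  proof (cases "k = 0")
    case True
    have "eventually (\<lambda>t. a k t = 0) (at_right 0)"
      using eventually_at_right_less[of 0] by eventually_elim (simp add: a_def True)
    then show ?thesis
      using True by (simp add: tendsto_eventually)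
  next
    case False
    then show ?thesis
      unfolding a_def by (intro powr_second_order_limit) simp
  qed
  have A_lim: "(A \<longlongrightarrow> Q) (at_right 0)"
    unfolding A_def Q_def by (intro tendsto_intros a_lim)
  have "filterlim (\<lambda>t::real. 2 * t) (at_right 0) (at_right 0)"
    by real_asymp
  then have A2_lim: "((\<lambda>t. A (2 * t)) \<longlongrightarrow> Q) (at_right 0)"
    by (rule filterlim_compose[OF A_lim])
  have G: "G t = 1 - \<delta> * t / 2 + t\<^sup>2 * A t" if "0 < t" for t
  proof -
    have pw: "(1 + t) powr (- real k / 2) = 1 - real k * t / 2 + t\<^sup>2 * a k t" for k
      using that by (simp add: a_def)
    have "G t = (\<Sum>k\<le>d. v k - v k * real k * t / 2 + t\<^sup>2 * (v k * a k t))"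
      unfolding G_def pw by (intro sum.cong refl) (simp add: algebra_simps)
    also have "\<dots> = (\<Sum>k\<le>d. v k) - \<delta> * t / 2 + t\<^sup>2 * A t"
      by (simp add: sum.distrib sum_subtractf \<delta>_def A_def sum_distrib_left sum_distrib_right sum_divide_distrib)
    finally show ?thesis
      by (simp add: sum1)
  qed
  have key: "4 * A (2 * t) - 2 * A t - \<delta>\<^sup>2 / 4 + \<delta> * t * A t - t\<^sup>2 * (A t)\<^sup>2 \<le> \<delta> - 4 * t * A (2 * t)" if t: "0 < t" for t
  proof -
    have "t\<^sup>2 * (4 * A (2 * t) - 2 * A t - \<delta>\<^sup>2 / 4 + \<delta> * t * A t - t\<^sup>2 * (A t)\<^sup>2) = G (2 * t) - (G t)\<^sup>2"
      using t by (simp add: G power2_eq_square algebra_simps)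
    also have "\<dots> \<le> t * (1 - G (2 * t))"
      by (rule ineq[OF t])
    also have "\<dots> = t\<^sup>2 * (\<delta> - 4 * t * A (2 * t))"
      using t by (simp add: G power2_eq_square algebra_simps)
    finally show ?thesis
      using t by simp
  qed
  have "4 * Q - 2 * Q - \<delta>\<^sup>2 / 4 + \<delta> * 0 * Q - 0\<^sup>2 * Q\<^sup>2 \<le> \<delta> - 4 * 0 * Q"
  proof (rule tendsto_le)
    show "((\<lambda>t. 4 * A (2 * t) - 2 * A t - \<delta>\<^sup>2 / 4 + \<delta> * t * A t - t\<^sup>2 * (A t)\<^sup>2) \<longlongrightarrow>
        4 * Q - 2 * Q - \<delta>\<^sup>2 / 4 + \<delta> * 0 * Q - 0\<^sup>2 * Q\<^sup>2) (at_right 0)"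
      by (intro tendsto_intros A_lim A2_lim)
    show "((\<lambda>t. \<delta> - 4 * t * A (2 * t)) \<longlongrightarrow> \<delta> - 4 * 0 * Q) (at_right 0)"
      by (intro tendsto_intros A2_lim)
    show "eventually (\<lambda>t. 4 * A (2 * t) - 2 * A t - \<delta>\<^sup>2 / 4 + \<delta> * t * A t - t\<^sup>2 * (A t)\<^sup>2
        \<le> \<delta> - 4 * t * A (2 * t)) (at_right 0)"
      using eventually_at_right_less[of 0] by eventually_elim (rule key)
  qed simp
  \<comment> \<open>Multiplied by 4, the limiting inequality reads m + 2 \<delta> - \<delta>^2 \<le>
    4 \<delta>, m being the second moment.\<close>
  moreover have "8 * Q = (\<Sum>k\<le>d. v k * (real k)\<^sup>2) + 2 * \<delta>"
    unfolding Q_def \<delta>_def sum_distrib_left sum.distrib[symmetric]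
    by (intro sum.cong refl) (simp add: power2_eq_square field_simps)
  ultimately show ?thesis
    by (simp add: \<delta>_def)
qed

lemma variance_intrinsic_volume_pmf_le:
  fixes C :: "(real ^ 'n) set"
  assumes C: "closed C" "convex_cone C"
  shows "measure_pmf.variance (intrinsic_volume_pmf C) real \<le> 2 * statistical_dimension C"
proof -
  let ?d = "DIM(real ^ 'n)" and ?v = "conic_intrinsic_volume C"
  define \<delta> where "\<delta> = (\<Sum>k\<le>?d. ?v k * real k)"
  have sd: "statistical_dimension C = \<delta>"
    by (simp add: statistical_dimension_def expectation_intrinsic_volume_pmf[OF C] \<delta>_def)
  have st: "(\<Sum>k\<le>?d. ?v k * (1 + t) powr (- real k / 2)) = steiner_transform C (1 / sqrt (1 + t)) 1"
    if t: "0 < t" for t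
  proof -
    have "(1 + t) powr (- real k / 2) = (1 / sqrt (1 + t)) ^ k" for k
    proof -
      have "1 / sqrt (1 + t) = (1 + t) powr (- 1 / 2)"
        using t by (simp add: powr_minus powr_half_sqrt field_simps)
      then show ?thesis
        using t by (simp add: powr_power)
    qed
    then show ?thesis
      using t by (simp add: conic_steiner_formula[OF C])
  qed
  have "(\<Sum>k\<le>?d. ?v k * (real k)\<^sup>2) - \<delta>\<^sup>2 \<le> 2 * \<delta>"
    unfolding \<delta>_def
  proof (rule variance_le_of_generating_function[OF sum_conic_intrinsic_volume[OF C]])
    fix t :: real assume t: "0 < t"
    then have t2: "0 < 2 * t" by simp
    show "(\<Sum>k\<le>?d. ?v k * (1 + 2 * t) powr (- real k / 2)) - (\<Sum>k\<le>?d. ?v k * (1 + t) powr (- real k / 2))\<^sup>2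
        \<le> t * (1 - (\<Sum>k\<le>?d. ?v k * (1 + 2 * t) powr (- real k / 2)))"
      unfolding st[OF t] st[OF t2] by (rule steiner_transform_poincare[OF C t])
  qed
  moreover have "measure_pmf.variance (intrinsic_volume_pmf C) real = (\<Sum>k\<le>?d. ?v k * (real k)\<^sup>2) - \<delta>\<^sup>2"
  proof -
    have "measure_pmf.variance (intrinsic_volume_pmf C) real = (\<Sum>k\<le>?d. ?v k * (real k - \<delta>)\<^sup>2)"
      by (simp only: expectation_intrinsic_volume_pmf[OF C] \<delta>_def)
    also have "\<dots> = (\<Sum>k\<le>?d. ?v k * (real k)\<^sup>2 - 2 * \<delta> * (?v k * real k) + \<delta>\<^sup>2 * ?v k)"
      by (intro sum.cong refl) (simp add: power2_eq_square algebra_simps)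
    also have "\<dots> = (\<Sum>k\<le>?d. ?v k * (real k)\<^sup>2) - 2 * \<delta> * \<delta> + \<delta>\<^sup>2 * (\<Sum>k\<le>?d. ?v k)"
      by (simp only: sum.distrib sum_subtractf sum_distrib_left[symmetric] \<delta>_def)
    also have "\<dots> = (\<Sum>k\<le>?d. ?v k * (real k)\<^sup>2) - \<delta>\<^sup>2"
      unfolding sum_conic_intrinsic_volume[OF C] by (simp add: power2_eq_square)
    finally show ?thesis .
  qed
  ultimately show ?thesis
    by (simp add: sd)
qed

text \<open>For the polar cone the random variable is distributed as d - V_C, and a reflection
  preserves the variance. The bound for the polar cone therefore also bounds the variance for
  \<open>C\<close>.\<close>

lemma variance_intrinsic_volume_pmf_polar_cone:
  fixes C :: "'a::euclidean_space set"
  assumes C: "closed C" "convex_cone C"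
  shows "measure_pmf.variance (intrinsic_volume_pmf (polar_cone C)) real = measure_pmf.variance (intrinsic_volume_pmf C) real"
proof -
  let ?d = "DIM('a)" and ?v = "conic_intrinsic_volume C"
  have polar: "measure_pmf.expectation (intrinsic_volume_pmf (polar_cone C)) f = (\<Sum>k\<le>?d. ?v k * f (?d - k))" for f :: "nat \<Rightarrow> real"
  proof -
    have "measure_pmf.expectation (intrinsic_volume_pmf (polar_cone C)) f = (\<Sum>k\<le>?d. ?v (?d - k) * f k)"
      by (simp add: expectation_intrinsic_volume_pmf[OF closed_polar_cone convex_cone_polar_cone]
          conic_intrinsic_volume_polar_cone[OF C])
    also have "\<dots> = (\<Sum>k\<le>?d. ?v k * f (?d - k))"
      by (rule sum.reindex_bij_witness[of _ "\<lambda>k. ?d - k" "\<lambda>k. ?d - k"]) auto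
    finally show ?thesis .
  qed
  define \<delta> where "\<delta> = (\<Sum>k\<le>?d. ?v k * real k)"
  have "(\<Sum>k\<le>?d. ?v k * real (?d - k)) = (\<Sum>k\<le>?d. real ?d * ?v k - ?v k * real k)"
    by (intro sum.cong refl) (simp add: of_nat_diff algebra_simps)
  also have "\<dots> = real ?d - \<delta>"
    by (simp add: sum_subtractf sum_distrib_left[symmetric] sum_conic_intrinsic_volume[OF C] \<delta>_def)
  finally have mean: "(\<Sum>k\<le>?d. ?v k * real (?d - k)) = real ?d - \<delta>" .
  have "measure_pmf.variance (intrinsic_volume_pmf (polar_cone C)) real = (\<Sum>k\<le>?d. ?v k * (real (?d - k) - (real ?d - \<delta>))\<^sup>2)"
    by (simp only: polar mean)
  also have "\<dots> = (\<Sum>k\<le>?d. ?v k * (real k - \<delta>)\<^sup>2)"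
    by (intro sum.cong refl) (simp add: of_nat_diff power2_commute)
  also have "\<dots> = measure_pmf.variance (intrinsic_volume_pmf C) real"
    by (simp only: expectation_intrinsic_volume_pmf[OF C] \<delta>_def)
  finally show ?thesis .
qed

theorem theorem4p5:
  fixes C :: "(real ^ 'n) set"
  assumes "closed C" and "convex_cone C"
  shows "measure_pmf.variance (intrinsic_volume_pmf C) real
           \<le> 2 * min (statistical_dimension C) (statistical_dimension (polar_cone C))"
  using variance_intrinsic_volume_pmf_le[OF assms]
    variance_intrinsic_volume_pmf_le[OF closed_polar_cone[of C] convex_cone_polar_cone[of C]]
  by (simp add: variance_intrinsic_volume_pmf_polar_cone[OF assms])

end
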